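(* Fix $\mu>0$, $F>0$, $E\in\mathbb{R}$, let $\gamma$ be the phase of the reference solution, and let $h:\mathbb{N}\to\mathbb{R}$ satisfy $\lim_{j\to\infty}|h(j+1)-h(j)|\,j^{1/4}=0$. Then, as $N\to\infty$, $$\sum_{j=1}^N\frac{e^{i(\mu\gamma(j)+h(j))}}{\gamma'(j)^2}=o(\log N).$$
   Context: The reference solution is $\zeta(x)=(\pi/F^{1/3})^{1/2}\bigl(i\,\mathrm{Ai}(-F^{1/3}(x+E/F))+\mathrm{Bi}(-F^{1/3}(x+E/F))\bigr)$, where $\mathrm{Ai},\mathrm{Bi}$ are the standard Airy functions. It has no real zeros, and $\gamma\in C^\infty(\mathbb{R})$ is the real function with $\zeta(x)=|\zeta(x)|e^{i\gamma(x)}$ and $\gamma(0)\in(-\pi,\pi]$. *)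

theory Defs
  imports "HOL-Analysis.Analysis" "HOL-Library.Landau_Symbols"
begin

text \<open>Airy functions via their Maclaurin series (DLMF 9.4.1--9.4.4):
  Ai(x) = c1 f(x) - c2 g(x),  Bi(x) = sqrt 3 (c1 f(x) + c2 g(x)), with
  f(x) = sum_k 3^k (1/3)_k x^(3k)/(3k)!,  g(x) = sum_k 3^k (2/3)_k x^(3k+1)/(3k+1)!,
  c1 = Ai(0) = 1/(3^(2/3) Gamma(2/3)),  c2 = -Ai'(0) = 1/(3^(1/3) Gamma(1/3)).\<close>

definition airy_f :: "real \<Rightarrow> real" where
  "airy_f x = (\<Sum>k. 3 ^ k * pochhammer (1/3) k * x ^ (3*k) / fact (3*k))"

definition airy_g :: "real \<Rightarrow> real" where
  "airy_g x = (\<Sum>k. 3 ^ k * pochhammer (2/3) k * x ^ (3*k+1) / fact (3*k+1))"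

definition airy_c1 :: real where
  "airy_c1 = 1 / (3 powr (2/3) * Gamma (2/3))"

definition airy_c2 :: real where
  "airy_c2 = 1 / (3 powr (1/3) * Gamma (1/3))"

definition Airy_Ai :: "real \<Rightarrow> real" where
  "Airy_Ai x = airy_c1 * airy_f x - airy_c2 * airy_g x"

definition Airy_Bi :: "real \<Rightarrow> real" where
  "Airy_Bi x = sqrt 3 * (airy_c1 * airy_f x + airy_c2 * airy_g x)"

definition ref_zeta :: "real \<Rightarrow> real \<Rightarrow> real \<Rightarrow> complex" where
  "ref_zeta F E x =
     complex_of_real (sqrt (pi / F powr (1/3))) *
       (\<i> * complex_of_real (Airy_Ai (- (F powr (1/3)) * (x + E / F)))
          + complex_of_real (Airy_Bi (- (F powr (1/3)) * (x + E / F))))"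

end

theory Submission
  imports Defs "HOL-Real_Asymp.Real_Asymp"
begin

text \<open>
  The Wronskian of the Airy functions gives \<open>\<gamma>' = 1 / \<bar>\<zeta>\<bar>\<^sup>2\<close>.  The function \<open>y = Ai\<^sup>2 + Bi\<^sup>2\<close> solves
  \<open>y''' = 4 x y' + 2 y\<close>, and so does the integral of \<open>exp (x s - s ^ 3 / 12) / sqrt s\<close> over \<open>s > 0\<close>;
  comparing Taylor coefficients at \<open>0\<close> identifies the two up to the factor \<open>\<pi>\<^bsup>3/2\<^esup>\<close>, and the
  behaviour of this Laplace integral at \<open>- \<infinity>\<close> gives \<open>\<gamma>' x = sqrt (F x) + o(1)\<close>.

  Since \<open>h\<close> has vanishing increments, \<open>u j = exp (i (\<mu> \<gamma> j + h j))\<close> satisfies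
  \<open>u (j + k) = u j exp (i k \<mu> sqrt (F j)) + o(1)\<close> for each fixed \<open>k\<close>.  Logarithmic means are
  asymptotically invariant under shifts, so averaging over \<open>k < K\<close> bounds the logarithmic mean of \<open>u\<close>
  by that of the modulus of a normalised Dirichlet kernel at \<open>\<mu> sqrt (F j)\<close>, whose logarithmic mean
  square tends to \<open>1 / K\<close>.
\<close>

subsection \<open>Logarithmic means\<close>

text \<open>Dividing by \<open>harm N\<close> rather than \<open>ln N\<close> makes the weights sum
  to exactly 1 for \<open>N\<close> at least 1, so constants are reproduced without an error term.
  Both real and complex sequences occur below.\<close>

definition log_mean :: "(nat \<Rightarrow> 'a::real_normed_vector) \<Rightarrow> nat \<Rightarrow> 'a" where
  "log_mean s N = (\<Sum>j=1..N. s j /\<^sub>R real j) /\<^sub>R harm N"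

lemma harm_at_top: "filterlim (harm :: nat \<Rightarrow> real) at_top sequentially"
proof (rule filterlim_at_top_mono)
  show "filterlim (\<lambda>n. ln (real n)) at_top sequentially"
    by real_asymp
  show "\<forall>\<^sub>F n in sequentially. ln (real n) \<le> harm n"
  proof (rule eventually_mono[OF eventually_ge_at_top[of 1]])
    fix n :: nat assume "1 \<le> n"
    then have "ln (real n) \<le> ln (real n + 1)" by simp
    also have "\<dots> \<le> harm n" by (rule ln_le_harm)
    finally show "ln (real n) \<le> harm n" .
  qed
qed

text \<open>\<open>harm n - ln n\<close> converges to the Euler-Mascheroni constant. This converts
  the normalisation of \<open>log_mean\<close> into the \<open>log N\<close> of the final
  estimate.\<close>

lemma harm_div_ln_tendsto_1: "(\<lambda>n. harm n / ln (real n)) \<longlonglongrightarrow> 1"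
proof -
  have "(\<lambda>n. (harm n - ln (real n)) / ln (real n) + 1) \<longlonglongrightarrow> 0 + 1"
    by (intro tendsto_add tendsto_const real_tendsto_divide_at_top[OF euler_mascheroni_LIMSEQ])
       real_asymp
  moreover have "\<forall>\<^sub>F n in sequentially. (harm n - ln (real n)) / ln (real n) + 1 = harm n / ln (real n)"
    by (rule eventually_mono[OF eventually_gt_at_top[of 1]]) (simp add: field_simps)
  ultimately show ?thesis
    by (simp add: tendsto_cong)
qed

lemma log_mean_cong: "(\<And>j. j \<ge> 1 \<Longrightarrow> s j = t j) \<Longrightarrow> log_mean s N = log_mean t N"
  unfolding log_mean_def by (intro arg_cong2[where f = scaleR] refl sum.cong) auto

lemma log_mean_add: "log_mean (\<lambda>j. s j + t j) N = log_mean s N + log_mean t N"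
  by (simp add: log_mean_def scaleR_add_right sum.distrib)

lemma log_mean_diff: "log_mean (\<lambda>j. s j - t j) N = log_mean s N - log_mean t N"
  by (simp add: log_mean_def scaleR_diff_right sum_subtractf)

lemma log_mean_mult_left:
  fixes c :: "'a::real_normed_algebra"
  shows "log_mean (\<lambda>j. c * s j) N = c * log_mean s N"
  by (simp add: log_mean_def sum_distrib_left)

lemma log_mean_sum: "log_mean (\<lambda>j. \<Sum>k\<in>A. s k j) N = (\<Sum>k\<in>A. log_mean (s k) N)"
  by (simp add: log_mean_def scaleR_sum_right sum.swap[of _ A])

lemma log_mean_of_real: "log_mean (\<lambda>j. of_real (s j)) N = of_real (log_mean s N)"
  by (simp add: log_mean_def scaleR_conv_of_real)

lemma log_mean_const:
  assumes "N \<ge> 1"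
  shows "log_mean (\<lambda>_. c) N = c"
proof -
  have "harm N > (0::real)"
    using assms by (simp add: harm_pos)
  then show ?thesis
    by (simp add: log_mean_def harm_def flip: scaleR_sum_left)
qed

lemma norm_log_mean_le: "norm (log_mean s N) \<le> log_mean (\<lambda>j. norm (s j)) N"
proof -
  have "norm (\<Sum>j=1..N. s j /\<^sub>R real j) \<le> (\<Sum>j=1..N. norm (s j) /\<^sub>R real j)"
    by (rule order_trans[OF norm_sum]) simp
  then show ?thesis
    by (simp add: log_mean_def harm_nonneg mult_left_mono)
qed

lemma log_mean_mono:
  fixes s t :: "nat \<Rightarrow> real"
  assumes "\<And>j. s j \<le> t j"
  shows "log_mean s N \<le> log_mean t N"
  unfolding log_mean_def real_scaleR_def
  by (intro mult_left_mono sum_mono assms) (auto simp: harm_nonneg)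

lemma log_mean_eventually_0:
  assumes "\<forall>\<^sub>F j in sequentially. s j = 0"
  shows "log_mean s \<longlonglongrightarrow> 0"
proof -
  obtain n where n: "\<And>j. j \<ge> n \<Longrightarrow> s j = 0"
    using assms by (auto simp: eventually_sequentially)
  have "(\<lambda>N. (1 / harm N) *\<^sub>R (\<Sum>j=1..n. s j /\<^sub>R real j)) \<longlonglongrightarrow> 0 *\<^sub>R (\<Sum>j=1..n. s j /\<^sub>R real j)"
    by (intro tendsto_scaleR tendsto_const real_tendsto_divide_at_top[OF tendsto_const] harm_at_top)
  moreover have "\<forall>\<^sub>F N in sequentially. (1 / harm N) *\<^sub>R (\<Sum>j=1..n. s j /\<^sub>R real j) = log_mean s N"
  proof (rule eventually_mono[OF eventually_ge_at_top[of n]])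
    fix N assume "n \<le> N"
    then have "(\<Sum>j=1..N. s j /\<^sub>R real j) = (\<Sum>j=1..n. s j /\<^sub>R real j)"
      by (intro sum.mono_neutral_right) (auto simp: n)
    then show "(1 / harm N) *\<^sub>R (\<Sum>j=1..n. s j /\<^sub>R real j) = log_mean s N"
      by (simp add: log_mean_def inverse_eq_divide)
  qed
  ultimately show ?thesis
    by (simp add: tendsto_cong)
qed

lemma log_mean_tendsto_0:
  assumes "s \<longlonglongrightarrow> 0"
  shows "log_mean s \<longlonglongrightarrow> 0"
proof (rule tendstoI)
  fix e :: real assume "e > 0"
  \<comment> \<open>\<open>r\<close> keeps only the large terms: it vanishes eventually, and
    \<open>norm (s j)\<close> is at most \<open>r j + e / 2\<close> for every
    \<open>j\<close>.\<close>
  define r where "r j = (if norm (s j) < e / 2 then 0 else norm (s j))" for j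
  have "\<forall>\<^sub>F j in sequentially. norm (s j) < e / 2"
    using assms \<open>e > 0\<close> by (auto simp: tendsto_iff dest: spec[of _ "e/2"])
  then have "\<forall>\<^sub>F j in sequentially. r j = 0"
    by eventually_elim (simp add: r_def)
  then have "log_mean r \<longlonglongrightarrow> 0"
    by (rule log_mean_eventually_0)
  then have "\<forall>\<^sub>F N in sequentially. \<bar>log_mean r N\<bar> < e / 2"
    using \<open>e > 0\<close> by (auto simp: tendsto_iff dest: spec[of _ "e/2"])
  then show "\<forall>\<^sub>F N in sequentially. dist (log_mean s N) 0 < e"
    using eventually_ge_at_top[of 1]
  proof eventually_elim
    case (elim N)
    have "norm (log_mean s N) \<le> log_mean (\<lambda>j. norm (s j)) N"
      by (rule norm_log_mean_le)
    also have "\<dots> \<le> log_mean (\<lambda>j. r j + e / 2) N"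
      using \<open>e > 0\<close> by (intro log_mean_mono) (auto simp: r_def)
    also have "\<dots> = log_mean r N + e / 2"
      using elim by (simp add: log_mean_add log_mean_const)
    finally show ?case
      using elim by simp
  qed
qed

text \<open>The factor \<open>real j\<close> cancels the weight \<open>1 / j\<close>, so the sum
  collapses to \<open>s (Suc N) - s 1\<close>, which stays bounded while \<open>harm N\<close>
  diverges. It plays the part of summation by parts in the next two arguments.\<close>

lemma log_mean_telescope:
  assumes "\<And>j. norm (s j) \<le> C"
  shows "log_mean (\<lambda>j. real j *\<^sub>R (s (Suc j) - s j)) \<longlonglongrightarrow> 0"
proof (rule Lim_null_comparison)
  show "(\<lambda>N. 2 * C / harm N) \<longlonglongrightarrow> 0"
    by (rule real_tendsto_divide_at_top[OF tendsto_const harm_at_top])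
  have "norm (log_mean (\<lambda>j. real j *\<^sub>R (s (Suc j) - s j)) N) \<le> 2 * C / harm N" for N
  proof -
    have "(\<Sum>j=1..N. (real j *\<^sub>R (s (Suc j) - s j)) /\<^sub>R real j) = (\<Sum>j=1..N. s (Suc j) - s j)"
      by (intro sum.cong) auto
    also have "\<dots> = s (Suc N) - s 1"
      by (induction N) auto
    finally have "norm (log_mean (\<lambda>j. real j *\<^sub>R (s (Suc j) - s j)) N) = norm (s (Suc N) - s 1) / harm N"
      by (simp add: log_mean_def harm_nonneg divide_inverse_commute)
    also have "norm (s (Suc N) - s 1) \<le> 2 * C"
      using norm_triangle_ineq4[of "s (Suc N)" "s 1"] assms[of "Suc N"] assms[of 1] by linarith
    finally show ?thesis
      by (simp add: divide_right_mono harm_nonneg)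
  qed
  then show "\<forall>\<^sub>F N in sequentially. norm (log_mean (\<lambda>j. real j *\<^sub>R (s (Suc j) - s j)) N) \<le> 2 * C / harm N"
    by simp
qed

text \<open>With \<open>v j = u j / j\<close>, the increment \<open>u (Suc j) - u j\<close> equals
  \<open>j * (v (Suc j) - v j) + v (Suc j)\<close> for \<open>j\<close> at least 1. The first
  summand telescopes and the second is a null sequence.\<close>

lemma log_mean_shift_Suc:
  assumes bd: "\<And>j. norm (u j) \<le> C"
  shows "(\<lambda>N. log_mean (\<lambda>j. u (Suc j)) N - log_mean u N) \<longlonglongrightarrow> 0"
proof -
  have "C \<ge> 0"
    using bd[of 0] norm_ge_zero order_trans by blast
  \<comment> \<open>The telescoping lemma wants a bound at every index; at \<open>j = 0\<close> the
    quotient is 0 because the inverse of 0 is 0.\<close>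
  have "norm (u j /\<^sub>R real j) \<le> C" for j
  proof (cases "j = 0")
    case False
    then have "inverse (real j) * norm (u j) \<le> 1 * C"
      by (intro mult_mono bd) (auto simp: field_simps)
    then show ?thesis by simp
  qed (use \<open>C \<ge> 0\<close> in simp)
  from log_mean_telescope[OF this]
  have 1: "log_mean (\<lambda>j. real j *\<^sub>R (u (Suc j) /\<^sub>R real (Suc j) - u j /\<^sub>R real j)) \<longlonglongrightarrow> 0" .
  have "(\<lambda>j. u (Suc j) /\<^sub>R real (Suc j)) \<longlonglongrightarrow> 0"
  proof (rule Lim_null_comparison)
    show "(\<lambda>j. C / real (Suc j)) \<longlonglongrightarrow> 0"
      by real_asymp
    show "\<forall>\<^sub>F j in sequentially. norm (u (Suc j) /\<^sub>R real (Suc j)) \<le> C / real (Suc j)"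
      by (intro always_eventually allI) (use bd in \<open>simp add: divide_inverse_commute mult_left_mono del: of_nat_Suc\<close>)
  qed
  then have 2: "log_mean (\<lambda>j. u (Suc j) /\<^sub>R real (Suc j)) \<longlonglongrightarrow> 0"
    by (rule log_mean_tendsto_0)
  have "u (Suc j) - u j = real j *\<^sub>R (u (Suc j) /\<^sub>R real (Suc j) - u j /\<^sub>R real j)
      + u (Suc j) /\<^sub>R real (Suc j)" if "j \<ge> 1" for j
  proof -
    have "real j *\<^sub>R (u (Suc j) /\<^sub>R real (Suc j) - u j /\<^sub>R real j) + u (Suc j) /\<^sub>R real (Suc j)
      = (real j * inverse (real (Suc j)) + inverse (real (Suc j))) *\<^sub>R u (Suc j) - u j"
      using that by (simp add: algebra_simps)
    also have "real j * inverse (real (Suc j)) + inverse (real (Suc j)) = 1"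
      by (simp add: field_simps)
    finally show ?thesis by simp
  qed
  then have "log_mean (\<lambda>j. u (Suc j) - u j) N =
      log_mean (\<lambda>j. real j *\<^sub>R (u (Suc j) /\<^sub>R real (Suc j) - u j /\<^sub>R real j)
        + u (Suc j) /\<^sub>R real (Suc j)) N" for N
    by (intro log_mean_cong)
  then show ?thesis
    using tendsto_add[OF 1 2] by (simp add: log_mean_add log_mean_diff)
qed

lemma log_mean_shift:
  assumes bd: "\<And>j. norm (u j) \<le> C"
  shows "(\<lambda>N. log_mean (\<lambda>j. u (j + k)) N - log_mean u N) \<longlonglongrightarrow> 0"
proof (induction k)
  case (Suc k)
  have "(\<lambda>N. log_mean (\<lambda>j. u (Suc j + k)) N - log_mean (\<lambda>j. u (j + k)) N) \<longlonglongrightarrow> 0"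
    using log_mean_shift_Suc[of "\<lambda>j. u (j + k)" C] bd by simp
  from tendsto_add[OF this Suc] show ?case by simp
qed simp

text \<open>The phase advances by about \<open>\<theta> / (2 * sqrt j)\<close> per step, so
  telescoping \<open>e j / sqrt j\<close> produces \<open>\<i> * \<theta> / 2 * e j\<close> up to a
  null sequence. Since \<theta> is nonzero, the mean of \<open>e\<close> itself must vanish.\<close>

lemma log_mean_cis_sqrt:
  assumes "\<theta> \<noteq> 0"
  shows "log_mean (\<lambda>j. cis (\<theta> * sqrt (real j))) \<longlonglongrightarrow> 0"
proof -
  define e where "e j = cis (\<theta> * sqrt (real j))" for j
  define d where "d j = \<theta> * (sqrt (real (Suc j)) - sqrt (real j))" for j
  have e_Suc: "e (Suc j) = e j * cis (d j)" for j
    by (simp add: e_def d_def cis_mult algebra_simps)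
  have norm_e [simp]: "norm (e j) = 1" for j
    by (simp add: e_def)
  let ?s = "\<lambda>j. e j /\<^sub>R sqrt (real j)"
  have "norm (?s j) \<le> 1" for j
    by (cases "j = 0") (auto simp: field_simps)
  from log_mean_telescope[OF this]
  have 1: "log_mean (\<lambda>j. real j *\<^sub>R (?s (Suc j) - ?s j)) \<longlonglongrightarrow> 0" .
  have "d \<longlonglongrightarrow> 0"
    unfolding d_def by real_asymp
  have d_lim: "(\<lambda>j. d j * sqrt (real j)) \<longlonglongrightarrow> \<theta> / 2"
    unfolding d_def by real_asymp
  have d_nz: "d j \<noteq> 0" for j
    using assms by (simp add: d_def)
  \<comment> \<open>The punctured filter \<open>at 0\<close> requires \<open>d j\<close> to avoid 0;
    it makes the difference quotient of \<open>exp\<close> at 0 available along this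
    sequence.\<close>
  have "filterlim (\<lambda>j. \<i> * complex_of_real (d j)) (at 0) sequentially"
    using \<open>d \<longlonglongrightarrow> 0\<close> d_nz by (auto simp: filterlim_at intro!: tendsto_eq_intros)
  then have cis_lim: "(\<lambda>j. (cis (d j) - 1) / (\<i> * of_real (d j))) \<longlonglongrightarrow> 1"
    unfolding cis_conv_exp by (rule filterlim_compose[OF lim_exp_minus_1])
  \<comment> \<open>\<open>q j\<close> is the error \<open>r j\<close> relative to
    \<open>e j\<close>, arranged so that each factor has a known limit: \<theta>/2 for
    \<open>d j * sqrt j\<close>, 1 for the difference quotient, and 0 for the change of
    \<open>1 / sqrt j\<close> multiplied by \<open>j\<close>.\<close>
  define q where "q j = of_real (d j * sqrt (real j)) * \<i> * ((cis (d j) - 1) / (\<i> * of_real (d j)))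
      - \<i> * of_real (\<theta> / 2)
      + of_real (real j * (1 / sqrt (real (Suc j)) - 1 / sqrt (real j))) * cis (d j)" for j
  define r where "r j = real j *\<^sub>R (?s (Suc j) - ?s j) - (\<i> * of_real (\<theta> / 2)) * e j" for j
  have r_eq: "r j = e j * q j" if "j \<ge> 1" for j
  proof -
    define a b where "a = complex_of_real (sqrt (real j))" and "b = complex_of_real (sqrt (real (Suc j)))"
    have "a * a = of_nat j"
      unfolding a_def of_real_mult [symmetric] by simp
    moreover have "a \<noteq> 0" "b \<noteq> 0"
      using that by (auto simp: a_def b_def)
    ultimately have "of_nat j / a = a"
      by (metis nonzero_mult_div_cancel_right)
    then have "of_nat j * (cis (d j) / b - 1 / a) = a * (cis (d j) - 1) + of_nat j * (1 / b - 1 / a) * cis (d j)"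
      by (simp add: algebra_simps)
    moreover have "r j = e j * (of_nat j * (cis (d j) / b - 1 / a) - \<i> * of_real (\<theta> / 2))"
      by (simp add: r_def e_Suc scaleR_conv_of_real a_def b_def field_simps)
    moreover have "q j = a * (cis (d j) - 1) + of_nat j * (1 / b - 1 / a) * cis (d j) - \<i> * of_real (\<theta> / 2)"
    proof -
      have "x * y * \<i> * (z / (\<i> * x)) = y * z" if "x \<noteq> 0" for x y z :: complex
        using that by (simp add: field_simps)
      from this[of "of_real (d j)" a "cis (d j) - 1"] show ?thesis
        using d_nz[of j] by (simp add: q_def a_def b_def)
    qed
    ultimately show ?thesis by simp
  qed
  have "q \<longlonglongrightarrow> of_real (\<theta> / 2) * \<i> * 1 - \<i> * of_real (\<theta> / 2) + of_real 0 * cis 0"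
    unfolding q_def
  proof (intro tendsto_add tendsto_diff tendsto_mult tendsto_of_real tendsto_cis tendsto_const
      d_lim cis_lim \<open>d \<longlonglongrightarrow> 0\<close>)
    show "(\<lambda>j. real j * (1 / sqrt (real (Suc j)) - 1 / sqrt (real j))) \<longlonglongrightarrow> 0"
      by real_asymp
  qed
  then have "(\<lambda>j. norm (q j)) \<longlonglongrightarrow> 0"
    by (intro tendsto_norm_zero) simp
  then have "r \<longlonglongrightarrow> 0"
    by (rule Lim_null_comparison[rotated])
       (auto simp: r_eq norm_mult intro: eventually_mono[OF eventually_ge_at_top[of 1]])
  have "(\<i> * of_real (\<theta> / 2)) * log_mean e N
      = log_mean (\<lambda>j. real j *\<^sub>R (?s (Suc j) - ?s j)) N - log_mean r N" for N
    unfolding log_mean_diff [symmetric] log_mean_mult_left [symmetric] by (simp add: r_def)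
  then have "(\<lambda>N. (\<i> * of_real (\<theta> / 2)) * log_mean e N) \<longlonglongrightarrow> 0"
    using tendsto_diff[OF 1 log_mean_tendsto_0[OF \<open>r \<longlonglongrightarrow> 0\<close>]] by (simp only: diff_0_right)
  then show ?thesis
    using assms by (simp add: tendsto_mult_left_iff flip: e_def)
qed


text \<open>Expanding the square gives a double sum of exponentials with frequencies
  \<open>(k - l) * \<theta>\<close>. The off-diagonal ones have mean tending to 0, and the
  \<open>K\<close> diagonal ones, divided by \<open>K ^ 2\<close>, leave
  \<open>1 / K\<close>.\<close>

lemma log_mean_norm_avg_cis_sqrt:
  assumes "\<theta> \<noteq> 0" "K > 0"
  shows "log_mean (\<lambda>j. (norm ((\<Sum>k<K. cis (real k * (\<theta> * sqrt (real j)))) / of_nat K))\<^sup>2)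
    \<longlonglongrightarrow> 1 / real K"
proof -
  let ?D = "\<lambda>j. (\<Sum>k<K. cis (real k * (\<theta> * sqrt (real j)))) / of_nat K"
  let ?e = "\<lambda>k l j. cis ((real k - real l) * \<theta> * sqrt (real j))"
  have sq: "complex_of_real ((norm (?D j))\<^sup>2) = (1 / of_nat K ^ 2) * (\<Sum>k<K. \<Sum>l<K. ?e k l j)" for j
  proof -
    have "complex_of_real ((norm (?D j))\<^sup>2) = ?D j * cnj (?D j)"
      by (rule complex_norm_square)
    also have "\<dots> = (1 / of_nat K ^ 2) * ((\<Sum>k<K. cis (real k * (\<theta> * sqrt (real j))))
        * (\<Sum>l<K. cnj (cis (real l * (\<theta> * sqrt (real j))))))"
      by (simp add: power2_eq_square)
    also have "\<dots> = (1 / of_nat K ^ 2) * (\<Sum>k<K. \<Sum>l<K. ?e k l j)"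
      unfolding sum_product by (simp add: cis_cnj cis_mult algebra_simps)
    finally show ?thesis .
  qed
  have "log_mean (?e k l) \<longlonglongrightarrow> (if k = l then 1 else 0)" for k l
  proof (cases "k = l")
    case True
    have "\<forall>\<^sub>F N in sequentially. log_mean (\<lambda>_. 1 :: complex) N = 1"
      by (rule eventually_mono[OF eventually_ge_at_top[of 1]]) (simp add: log_mean_const)
    then show ?thesis
      using True by (simp add: tendsto_eventually)
  next
    case False
    then show ?thesis
      using log_mean_cis_sqrt[of "(real k - real l) * \<theta>"] assms by simp
  qed
  then have "(\<lambda>N. (1 / of_nat K ^ 2) * (\<Sum>k<K. \<Sum>l<K. log_mean (?e k l) N)) \<longlonglongrightarrow>
      (1 / of_nat K ^ 2) * (\<Sum>k<K. \<Sum>l<K. (if k = l then 1 else 0))"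
    by (intro tendsto_mult tendsto_const tendsto_sum)
  also have "(1 / of_nat K ^ 2) * (\<Sum>k<K. \<Sum>l<K. (if k = l then 1 else 0)) = complex_of_real (1 / real K)"
    using assms by (simp add: power2_eq_square)
  also have "(\<lambda>N. (1 / of_nat K ^ 2) * (\<Sum>k<K. \<Sum>l<K. log_mean (?e k l) N)) =
      (\<lambda>N. complex_of_real (log_mean (\<lambda>j. (norm (?D j))\<^sup>2) N))"
    unfolding log_mean_of_real [symmetric] sq log_mean_mult_left log_mean_sum ..
  finally show ?thesis
    unfolding tendsto_of_real_iff .
qed

text \<open>Shift invariance lets \<open>u j\<close> be replaced in the mean by the average of
  \<open>u (j + k)\<close> over \<open>k < K\<close>, which is close to \<open>u j * D j\<close> for
  the normalised Dirichlet kernel \<open>D\<close>. Only the mean size of \<open>D\<close> then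
  matters.\<close>

lemma log_mean_slowly_varying_frequency:
  assumes "\<theta> \<noteq> 0" and norm_u: "\<And>j. norm (u j) = 1"
    and shift: "\<And>k. (\<lambda>j. u (j + k) - u j * cis (real k * (\<theta> * sqrt (real j)))) \<longlonglongrightarrow> 0"
  shows "log_mean u \<longlonglongrightarrow> 0"
proof (rule tendstoI)
  fix e :: real assume "e > 0"
  obtain n where n: "inverse (real (Suc n)) < e / 2"
    using reals_Archimedean[of "e / 2"] \<open>e > 0\<close> by auto
  define m where "m = Suc n"
  \<comment> \<open>The later bound is \<open>m / 2\<close> times the mean square of
    \<open>D\<close>, plus \<open>1 / (2 * m)\<close>. With mean square near \<open>1 / K\<close>,
    the choice \<open>K = m ^ 2\<close> makes both terms about \<open>1 / (2 * m)\<close>.\<close>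
  define K where "K = m\<^sup>2"
  have "m > 0" "K > 0" "1 / real m < e / 2"
    using n by (auto simp: m_def K_def inverse_eq_divide)
  define D where "D j = (\<Sum>k<K. cis (real k * (\<theta> * sqrt (real j)))) / of_nat K" for j
  have "(\<lambda>N. log_mean u N - log_mean (\<lambda>j. u j * D j) N) \<longlonglongrightarrow> 0"
  proof -
    \<comment> \<open>In the \<open>k\<close>-th summand the means of \<open>u (j + k)\<close>
      cancel, leaving the mean of \<open>u\<close> minus that of \<open>u\<close> times the
      \<open>k\<close>-th exponential; both bracketed differences tend to 0.\<close>
    have "(\<lambda>N. (1 / of_nat K) * (\<Sum>k<K.
        log_mean (\<lambda>j. u (j + k) - u j * cis (real k * (\<theta> * sqrt (real j)))) N
        - (log_mean (\<lambda>j. u (j + k)) N - log_mean u N)))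
      \<longlonglongrightarrow> (1 / of_nat K) * (\<Sum>k<K. 0 - 0)"
      by (intro tendsto_intros log_mean_tendsto_0 shift log_mean_shift[of _ 1]) (simp add: norm_u)
    moreover have "(1 / of_nat K) * (\<Sum>k<K.
        log_mean (\<lambda>j. u (j + k) - u j * cis (real k * (\<theta> * sqrt (real j)))) N
        - (log_mean (\<lambda>j. u (j + k)) N - log_mean u N)) = log_mean u N - log_mean (\<lambda>j. u j * D j) N" for N
    proof -
      have "(\<lambda>j. u j * D j) = (\<lambda>j. (1 / of_nat K) * (\<Sum>k<K. u j * cis (real k * (\<theta> * sqrt (real j)))))"
        by (simp add: D_def sum_distrib_left sum_divide_distrib fun_eq_iff)
      then have "log_mean (\<lambda>j. u j * D j) N =
          (1 / of_nat K) * (\<Sum>k<K. log_mean (\<lambda>j. u j * cis (real k * (\<theta> * sqrt (real j)))) N)"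
        by (simp only: log_mean_mult_left log_mean_sum)
      then show ?thesis
        using \<open>K > 0\<close> by (simp add: log_mean_diff sum_subtractf right_diff_distrib)
    qed
    ultimately show ?thesis by simp
  qed
  \<comment> \<open>This tolerance is positive because \<open>1 / m < e / 2\<close>; added to
    \<open>e / 4 + 1 / (2 * m)\<close> below it gives exactly \<open>e / 2\<close>.\<close>
  then have "\<forall>\<^sub>F N in sequentially. norm (log_mean u N - log_mean (\<lambda>j. u j * D j) N) < (e / 2 - 1 / m) / 2"
    using \<open>1 / real m < e / 2\<close> by (auto simp: tendsto_iff dest: spec[of _ "(e / 2 - 1 / m) / 2"])
  moreover have "log_mean (\<lambda>j. (norm (D j))\<^sup>2) \<longlonglongrightarrow> 1 / real K"
    unfolding D_def by (rule log_mean_norm_avg_cis_sqrt) fact+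
  then have "(\<lambda>N. real m / 2 * log_mean (\<lambda>j. (norm (D j))\<^sup>2) N) \<longlonglongrightarrow> real m / 2 * (1 / real K)"
    by (intro tendsto_intros)
  then have "\<forall>\<^sub>F N in sequentially. real m / 2 * log_mean (\<lambda>j. (norm (D j))\<^sup>2) N < e / 4"
    by (rule order_tendstoD) (use \<open>m > 0\<close> \<open>1 / real m < e / 2\<close> in \<open>simp add: K_def power2_eq_square field_simps\<close>)
  ultimately show "\<forall>\<^sub>F N in sequentially. dist (log_mean u N) 0 < e"
    using eventually_ge_at_top[of 1]
  proof eventually_elim
    case (elim N)
    \<comment> \<open>This linear bound by the square replaces the Cauchy-Schwarz inequality for
      logarithmic means; it is the displayed square divided by \<open>2 * m\<close>.\<close>
    have amgm: "norm (u j * D j) \<le> real m / 2 * (norm (D j))\<^sup>2 + 1 / (2 * real m)" for j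
    proof -
      have "0 \<le> (real m * norm (D j) - 1)\<^sup>2"
        by simp
      then show ?thesis
        using \<open>m > 0\<close> by (simp add: norm_mult norm_u power2_eq_square field_simps)
    qed
    have "norm (log_mean (\<lambda>j. u j * D j) N) \<le> log_mean (\<lambda>j. norm (u j * D j)) N"
      by (rule norm_log_mean_le)
    also have "\<dots> \<le> log_mean (\<lambda>j. real m / 2 * (norm (D j))\<^sup>2 + 1 / (2 * real m)) N"
      by (rule log_mean_mono) (rule amgm)
    also have "\<dots> = real m / 2 * log_mean (\<lambda>j. (norm (D j))\<^sup>2) N + 1 / (2 * real m)"
      using elim(3) by (simp add: log_mean_add log_mean_mult_left log_mean_const del: times_divide_eq_left)
    finally have "norm (log_mean (\<lambda>j. u j * D j) N) < e / 4 + 1 / (2 * real m)"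
      using elim(2) by simp
    moreover define w where "w = 1 / (2 * real m)"
    moreover have "1 / real m = 2 * w"
      by (simp add: w_def)
    moreover have "norm (log_mean u N) \<le> norm (log_mean u N - log_mean (\<lambda>j. u j * D j) N)
        + norm (log_mean (\<lambda>j. u j * D j) N)"
      by (metis add.commute norm_triangle_sub)
    ultimately show ?case
      using elim(1) \<open>1 / real m < e / 2\<close> \<open>e > 0\<close> by simp
  qed
qed

subsection \<open>Power series of the Airy functions\<close>

text \<open>Taylor coefficients at 0 of the solution of \<open>y'' = x * y\<close> with
  \<open>y 0 = p\<close> and \<open>y' 0 = q\<close>. Keeping both initial values as parameters
  treats \<open>airy_f\<close>, \<open>airy_g\<close>, Ai and Bi at once.\<close>

fun airy_coeff :: "real \<Rightarrow> real \<Rightarrow> nat \<Rightarrow> real" where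
  "airy_coeff p q 0 = p"
| "airy_coeff p q (Suc 0) = q"
| "airy_coeff p q (Suc (Suc 0)) = 0"
| "airy_coeff p q (Suc (Suc (Suc n))) = airy_coeff p q n / (real (n + 2) * real (n + 3))"

definition airy_fps :: "real \<Rightarrow> real \<Rightarrow> real fps" where
  "airy_fps p q = Abs_fps (airy_coeff p q)"

lemma airy_coeff_linear: "airy_coeff p q n = p * airy_coeff 1 0 n + q * airy_coeff 0 1 n"
  by (induction p q n rule: airy_coeff.induct) (auto simp: add_divide_distrib)

text \<open>The recursion advances by 3, so a vanishing seed forces zeros throughout its residue
  class. This permits the full series to be reindexed to the sparse ones that define
  \<open>airy_f\<close> and \<open>airy_g\<close>.\<close>

lemma airy_coeff_mod_3:
  "n mod 3 = 2 \<Longrightarrow> airy_coeff p q n = 0"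
  "n mod 3 = 1 \<Longrightarrow> airy_coeff p 0 n = 0"
  "n mod 3 = 0 \<Longrightarrow> airy_coeff 0 q n = 0"
proof -
  have *: "(n mod 3 = 2 \<longrightarrow> airy_coeff p q n = 0) \<and> (n mod 3 = 1 \<longrightarrow> airy_coeff p 0 n = 0)
      \<and> (n mod 3 = 0 \<longrightarrow> airy_coeff 0 q n = 0)"
    by (induction p q n rule: airy_coeff.induct) (auto simp: mod_Suc split: if_splits)
  then show "n mod 3 = 2 \<Longrightarrow> airy_coeff p q n = 0"
    "n mod 3 = 1 \<Longrightarrow> airy_coeff p 0 n = 0" "n mod 3 = 0 \<Longrightarrow> airy_coeff 0 q n = 0"
    by auto
qed

lemma airy_coeff_add_3: "airy_coeff p q (n + 3) = airy_coeff p q n / ((real n + 2) * (real n + 3))"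
  by (simp add: eval_nat_numeral algebra_simps)

lemma fact_add_3: "fact (n + 3) = (real n + 3) * ((real n + 2) * ((real n + 1) * fact n))"
  by (simp add: eval_nat_numeral algebra_simps)

lemma airy_coeff_f: "airy_coeff 1 0 (3 * k) = 3 ^ k * pochhammer (1/3) k / fact (3 * k)"
proof (induction k)
  case (Suc k)
  have "airy_coeff 1 0 (3 * Suc k) = airy_coeff 1 0 (3 * k) / ((real (3 * k) + 2) * (real (3 * k) + 3))"
    using airy_coeff_add_3[of 1 0 "3 * k"] by (simp add: add.commute)
  moreover have "fact (3 * Suc k) = (real (3 * k) + 3) * ((real (3 * k) + 2) * ((real (3 * k) + 1) * fact (3 * k)))"
    using fact_add_3[of "3 * k"] by (simp add: add.commute)
  moreover have "3 ^ Suc k * pochhammer (1/3) (Suc k) = 3 ^ k * pochhammer (1/3) k * (real (3 * k) + 1)"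
    by (simp add: pochhammer_Suc algebra_simps)
  ultimately show ?case
    by (simp add: Suc.IH del: of_nat_mult power_Suc)
qed simp

lemma airy_coeff_g: "airy_coeff 0 1 (3 * k + 1) = 3 ^ k * pochhammer (2/3) k / fact (3 * k + 1)"
proof (induction k)
  case (Suc k)
  define n where "n = 3 * k + 1"
  have n: "3 * Suc k + 1 = n + 3"
    by (simp add: n_def)
  have "3 ^ Suc k * pochhammer (2/3) (Suc k) = 3 ^ k * pochhammer (2/3) k * (real n + 1)"
    by (simp add: pochhammer_Suc algebra_simps n_def)
  moreover have "airy_coeff 0 1 n = 3 ^ k * pochhammer (2/3) k / fact n"
    using Suc.IH by (simp only: n_def)
  ultimately show ?case
    unfolding n airy_coeff_add_3 fact_add_3 by (simp del: power_Suc)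
qed simp

text \<open>Each step divides by \<open>(n + 2) * (n + 3)\<close>, which is at least
  \<open>k + 1\<close>. This crude factorial decay allows comparison with the exponential series at
  \<open>\<bar>x\<bar> ^ 3\<close>.\<close>

lemma airy_coeff_bound:
  "\<bar>airy_coeff 1 0 (3 * k)\<bar> \<le> 1 / fact k" "\<bar>airy_coeff 0 1 (3 * k + 1)\<bar> \<le> 1 / fact k"
proof -
  have step: "\<bar>x / (real (n + 2) * real (n + 3))\<bar> \<le> 1 / fact (Suc k)"
    if "\<bar>x\<bar> \<le> 1 / fact k" "n \<ge> k" for x :: real and n k
  proof -
    have "1 * real (Suc k) \<le> real (n + 2) * real (n + 3)"
      using that by (intro mult_mono) auto
    then have "\<bar>x\<bar> / \<bar>real (n + 2) * real (n + 3)\<bar> \<le> (1 / fact k) / (1 * real (Suc k))"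
      by (intro frac_le that) auto
    then show ?thesis by (simp add: abs_divide mult.commute)
  qed
  show "\<bar>airy_coeff 1 0 (3 * k)\<bar> \<le> 1 / fact k"
  proof (induction k)
    case (Suc k)
    have "3 * Suc k = Suc (Suc (Suc (3 * k)))" by simp
    then show ?case using step[OF Suc.IH, of "3 * k"] by (simp only: airy_coeff.simps)
  qed simp
  show "\<bar>airy_coeff 0 1 (3 * k + 1)\<bar> \<le> 1 / fact k"
  proof (induction k)
    case (Suc k)
    have "3 * Suc k + 1 = Suc (Suc (Suc (3 * k + 1)))" by simp
    then show ?case using step[OF Suc.IH, of "3 * k + 1"] by (simp only: airy_coeff.simps)
  qed simp
qed

lemma airy_coeff_summable:
  fixes x :: real
  shows "summable (\<lambda>k. airy_coeff 1 0 (3 * k) * x ^ (3 * k))"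
    "summable (\<lambda>k. airy_coeff 0 1 (3 * k + 1) * x ^ (3 * k + 1))"
proof -
  have exp: "summable (\<lambda>k. inverse (fact k) * (\<bar>x\<bar> ^ 3) ^ k)" "summable (\<lambda>k. \<bar>x\<bar> * (inverse (fact k) * (\<bar>x\<bar> ^ 3) ^ k))"
    by (intro summable_mult summable_exp)+
  have "\<bar>airy_coeff 1 0 (3 * k) * x ^ (3 * k)\<bar> \<le> inverse (fact k) * (\<bar>x\<bar> ^ 3) ^ k" for k
    using airy_coeff_bound(1)[of k]
    by (simp add: abs_mult power_mult power_abs inverse_eq_divide mult_right_mono del: times_divide_eq_left)
  then show "summable (\<lambda>k. airy_coeff 1 0 (3 * k) * x ^ (3 * k))"
    by (intro summable_comparison_test'[OF exp(1), of 0]) simp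
  have "\<bar>airy_coeff 0 1 (3 * k + 1) * x ^ (3 * k + 1)\<bar> \<le> \<bar>x\<bar> * (inverse (fact k) * (\<bar>x\<bar> ^ 3) ^ k)" for k
  proof -
    have "\<bar>airy_coeff 0 1 (3 * k + 1) * x ^ (3 * k + 1)\<bar> = \<bar>airy_coeff 0 1 (3 * k + 1)\<bar> * (\<bar>x\<bar> * (\<bar>x\<bar> ^ 3) ^ k)"
      by (simp add: abs_mult power_mult power_abs)
    also have "\<dots> \<le> (1 / fact k) * (\<bar>x\<bar> * (\<bar>x\<bar> ^ 3) ^ k)"
      by (intro mult_right_mono airy_coeff_bound) auto
    finally show ?thesis by (simp add: field_simps)
  qed
  then show "summable (\<lambda>k. airy_coeff 0 1 (3 * k + 1) * x ^ (3 * k + 1))"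
    by (intro summable_comparison_test'[OF exp(2), of 0]) simp
qed

lemma airy_coeff_sums: "(\<lambda>n. airy_coeff p q n * x ^ n) sums (p * airy_f x + q * airy_g x)"
proof -
  have 1: "(\<lambda>n. airy_coeff 1 0 n * x ^ n) sums airy_f x"
  proof (subst sums_mono_reindex[of "\<lambda>k. 3 * k", symmetric])
    show "strict_mono (\<lambda>k::nat. 3 * k)" by (simp add: strict_mono_def)
    show "airy_coeff 1 0 n * x ^ n = 0" if "n \<notin> range (\<lambda>k. 3 * k)" for n
    proof -
      have "n mod 3 \<noteq> 0" using that by (auto simp: mod_eq_0_iff_dvd elim: dvdE)
      then have "n mod 3 = 1 \<or> n mod 3 = 2" by linarith
      then show ?thesis by (auto simp: airy_coeff_mod_3)
    qed
    show "(\<lambda>k. airy_coeff 1 0 (3 * k) * x ^ (3 * k)) sums airy_f x"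
      using summable_sums[OF airy_coeff_summable(1)[of x]] by (simp add: airy_f_def airy_coeff_f)
  qed
  have 2: "(\<lambda>n. airy_coeff 0 1 n * x ^ n) sums airy_g x"
  proof (subst sums_mono_reindex[of "\<lambda>k. 3 * k + 1", symmetric])
    show "strict_mono (\<lambda>k::nat. 3 * k + 1)" by (simp add: strict_mono_def)
    show "airy_coeff 0 1 n * x ^ n = 0" if "n \<notin> range (\<lambda>k. 3 * k + 1)" for n
    proof -
      have "n mod 3 \<noteq> 1"
      proof
        assume "n mod 3 = 1"
        then have "n = 3 * (n div 3) + 1" by presburger
        with that show False by blast
      qed
      then have "n mod 3 = 0 \<or> n mod 3 = 2" by linarith
      then show ?thesis by (auto simp: airy_coeff_mod_3)
    qed
    show "(\<lambda>k. airy_coeff 0 1 (3 * k + 1) * x ^ (3 * k + 1)) sums airy_g x"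
      using summable_sums[OF airy_coeff_summable(2)[of x]] unfolding airy_g_def airy_coeff_g by simp
  qed
  have "(\<lambda>n. p * (airy_coeff 1 0 n * x ^ n) + q * (airy_coeff 0 1 n * x ^ n)) sums (p * airy_f x + q * airy_g x)"
    by (intro sums_add sums_mult 1 2)
  then show ?thesis
    by (subst airy_coeff_linear) (simp add: algebra_simps)
qed

lemma fps_conv_radius_airy_fps [simp]: "fps_conv_radius (airy_fps p q) = \<infinity>"
  unfolding fps_conv_radius_def airy_fps_def fps_nth_Abs_fps
  by (rule conv_radius_inftyI'') (rule sums_summable[OF airy_coeff_sums])

lemma eval_airy_fps: "eval_fps (airy_fps p q) x = p * airy_f x + q * airy_g x"
  using sums_unique[OF airy_coeff_sums] by (simp add: eval_fps_def airy_fps_def)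

lemma airy_fps_deriv2: "fps_deriv (fps_deriv (airy_fps p q)) = fps_X * airy_fps p q"
proof (rule fps_ext)
  fix n
  show "fps_nth (fps_deriv (fps_deriv (airy_fps p q))) n = fps_nth (fps_X * airy_fps p q) n"
  proof (cases n)
    case (Suc m)
    have "fps_nth (fps_deriv (fps_deriv (airy_fps p q))) (Suc m)
        = (real m + 2) * ((real m + 3) * airy_coeff p q (m + 3))"
      by (simp add: airy_fps_def eval_nat_numeral add_ac del: airy_coeff.simps)
    then show ?thesis
      unfolding Suc airy_coeff_add_3 by (simp add: airy_fps_def)
  qed (simp add: airy_fps_def eval_nat_numeral)
qed

text \<open>The power series of \<open>Ai ^ 2 + Bi ^ 2\<close>: the two parameter pairs are the
  values and derivatives of Ai and Bi at 0.\<close>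

definition airy_mod_fps :: "real fps" where
  "airy_mod_fps = airy_fps airy_c1 (- airy_c2) ^ 2 + airy_fps (sqrt 3 * airy_c1) (sqrt 3 * airy_c2) ^ 2"

text \<open>From \<open>A'' = X * A\<close> one gets
  \<open>(A ^ 2)'' = 2 * A' ^ 2 + 2 * X * A ^ 2\<close>; differentiating once more and eliminating
  \<open>A''\<close> again closes the equation. It is linear, so it passes to sums of
  squares.\<close>

lemma airy_square_deriv3:
  assumes "fps_deriv (fps_deriv A) = fps_X * A"
  shows "fps_deriv (fps_deriv (fps_deriv (A ^ 2 :: 'a::comm_ring_1 fps))) = 4 * fps_X * fps_deriv (A ^ 2) + 2 * A ^ 2"
  by (simp add: power2_eq_square assms algebra_simps)

text \<open>The third-order equation read off at coefficient \<open>n\<close>. It links only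
  \<open>n\<close> and \<open>n + 3\<close>, so three initial coefficients determine the
  series.\<close>

lemma airy_mod_coeff_rec:
  "real (n + 3) * real (n + 2) * real (n + 1) * fps_nth airy_mod_fps (n + 3) = real (4 * n + 2) * fps_nth airy_mod_fps n"
proof -
  have "fps_deriv (fps_deriv (fps_deriv airy_mod_fps)) = 4 * fps_X * fps_deriv airy_mod_fps + 2 * airy_mod_fps"
    unfolding airy_mod_fps_def fps_deriv_add airy_square_deriv3[OF airy_fps_deriv2]
    by (simp add: algebra_simps)
  then have "fps_nth (fps_deriv (fps_deriv (fps_deriv airy_mod_fps))) n
      = fps_nth (fps_const 4 * (fps_X * fps_deriv airy_mod_fps) + fps_const 2 * airy_mod_fps) n"
    by (simp add: mult.assoc flip: numeral_fps_const)
  then show ?thesis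
    by (cases n) (simp_all add: eval_nat_numeral algebra_simps)
qed

section \<open>Gamma function identities behind the Airy constants\<close>

lemma Gamma_third_reflection: "Gamma (1/3) * Gamma (2/3) = 2 * pi / sqrt (3::real)"
proof -
  have "Gamma (complex_of_real (1/3)) * Gamma (1 - of_real (1/3)) = of_real pi / sin (of_real pi * of_real (1/3))"
    by (rule Gamma_reflection_complex)
  also have "1 - complex_of_real (1/3) = of_real (2/3)" by simp
  also have "of_real pi / sin (of_real pi * complex_of_real (1/3)) = of_real (pi / sin (pi / 3))"
    by (simp flip: sin_of_real of_real_mult)
  finally have "Gamma (1/3) * Gamma (2/3) = pi / sin (pi / 3)"
    unfolding Gamma_complex_of_real of_real_mult [symmetric] of_real_eq_iff .
  then show ?thesis by (simp add: sin_60)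
qed

lemma Gamma_legendre_duplication_real:
  fixes x :: real
  assumes "x > 0"
  shows "Gamma x * Gamma (x + 1/2) = 2 powr (1 - 2 * x) * sqrt pi * Gamma (2 * x)"
proof -
  have "complex_of_real x \<notin> \<int>\<^sub>\<le>\<^sub>0" "complex_of_real x + 1/2 \<notin> \<int>\<^sub>\<le>\<^sub>0"
    using assms by (auto elim!: nonpos_Ints_cases simp: complex_eq_iff)
  from Gamma_legendre_duplication[OF this]
  have "Gamma (complex_of_real x) * Gamma (of_real (x + 1/2)) =
      of_real (exp ((1 - 2 * x) * ln 2)) * of_real (sqrt pi) * Gamma (of_real (2 * x))"
    by (simp flip: exp_of_real)
  then show ?thesis
    unfolding Gamma_complex_of_real of_real_mult [symmetric] of_real_eq_iff by (simp add: powr_def)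
qed

lemma airy_c1_c2: "airy_c1 * airy_c2 = 1 / (2 * sqrt 3 * pi)"
proof -
  have "airy_c1 * airy_c2 = 1 / (3 powr (2/3 + 1/3) * (Gamma (1/3) * Gamma (2/3)))"
    unfolding powr_add by (simp add: airy_c1_def airy_c2_def)
  also have "\<dots> = 1 / (2 * sqrt 3 * pi)"
    unfolding Gamma_third_reflection by (simp add: field_simps)
  finally show ?thesis .
qed

subsection \<open>Laplace integral for the squared Airy modulus\<close>

text \<open>The substitution \<open>v = c * s ^ p\<close> in Euler's integral for
  \<open>Gamma (a / p)\<close>.\<close>

lemma has_integral_powr_exp:
  fixes a c :: real and p :: nat
  assumes "a > 0" "c > 0" "p > 0"
  shows "((\<lambda>s. s powr (a - 1) * exp (- c * s ^ p)) has_integral Gamma (a / p) / (p * c powr (a / p))) {0<..}"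
proof -
  define f where "f v = v powr (a / p - 1) / exp v" for v :: real
  define g where "g s = c * s ^ p" for s :: real
  define g' where "g' s = c * (p * s ^ (p - 1))" for s :: real
  have f0: "(f has_integral Gamma (a / p)) {0<..}"
  proof -
    \<comment> \<open>Euler's integral is stated on the closed half-line; removing the single point
      0 gives the open domain on which the substitution is a bijection.\<close>
    have "((\<lambda>t. if t \<in> {0<..} then f t else 0) has_integral Gamma (a / p)) {0..}"
      unfolding f_def
      by (rule has_integral_spike[OF negligible_sing[of 0] _ Gamma_integral_real]) (use assms in auto)
    then show ?thesis
      by (subst (asm) has_integral_restrict) auto
  qed
  have fabs: "f absolutely_integrable_on {0<..}"
    by (rule nonnegative_absolutely_integrable_1) (use f0 in \<open>auto simp: f_def has_integral_integrable\<close>)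
  have img: "g ` {0<..} = {0<..}"
  proof (intro equalityI subsetI)
    fix v :: real assume "v \<in> {0<..}"
    then have "v = g (root p (v / c))" "root p (v / c) \<in> {0<..}"
      using assms by (auto simp: g_def)
    then show "v \<in> g ` {0<..}" by blast
  qed (use assms in \<open>auto simp: g_def\<close>)
  have inj: "inj_on g {0<..}"
    using assms by (auto simp: inj_on_def g_def power_eq_iff_eq_base)
  have der: "(g has_field_derivative g' s) (at s within {0<..})" for s
    unfolding g_def g'_def by (auto intro!: derivative_eq_intros)
  have "(\<lambda>s. \<bar>g' s\<bar> * f (g s)) absolutely_integrable_on {0<..} \<and>
      integral {0<..} (\<lambda>s. \<bar>g' s\<bar> * f (g s)) = Gamma (a / p)"
    by (subst has_absolute_integral_change_of_variables_1'[OF _ der inj])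
      (use fabs f0 in \<open>auto simp: img integral_unique\<close>)
  then have abs: "(\<lambda>s. \<bar>g' s\<bar> * f (g s)) absolutely_integrable_on {0<..}"
    and int: "((\<lambda>s. \<bar>g' s\<bar> * f (g s)) has_integral Gamma (a / p)) {0<..}"
    by (auto simp: has_integral_iff absolutely_integrable_on_def)
  have eq: "\<bar>g' s\<bar> * f (g s) / (p * c powr (a / p)) = s powr (a - 1) * exp (- c * s ^ p)" if "s \<in> {0<..}" for s
  proof -
    have s: "s > 0" using that by simp
    have "f (g s) = c powr (a / p - 1) * (s powr p) powr (a / p - 1) * exp (- c * s ^ p)"
      using s assms by (simp add: f_def g_def powr_mult powr_realpow exp_minus divide_inverse)
    also have "(s powr p) powr (a / p - 1) = s powr (a - p)"
    proof -
      have "real p * (a / p - 1) = a - p"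
        using assms by (simp add: right_diff_distrib)
      then show ?thesis by (simp add: powr_powr)
    qed
    finally have f: "f (g s) = c powr (a / p - 1) * s powr (a - p) * exp (- c * s ^ p)" .
    have "\<bar>g' s\<bar> = c * (p * s powr (real p - 1))"
      using s assms by (simp add: g'_def powr_realpow[symmetric] of_nat_diff)
    then have "\<bar>g' s\<bar> * f (g s) = p * (c * c powr (a / p - 1)) * (s powr (real p - 1) * s powr (a - p)) * exp (- c * s ^ p)"
      by (simp add: f)
    also have "c * c powr (a / p - 1) = c powr (a / p)"
      using assms by (simp add: powr_diff)
    also have "s powr (real p - 1) * s powr (a - p) = s powr (a - 1)"
      by (simp flip: powr_add)
    finally show ?thesis
      using assms by simp
  qed
  from has_integral_eq[OF eq has_integral_divide[OF int]]
  show "((\<lambda>s. s powr (a - 1) * exp (- c * s ^ p)) has_integral Gamma (a / p) / (p * c powr (a / p))) {0<..}" .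
qed

text \<open>The value of the integral of \<open>s powr (n - 1/2) * exp (- (s ^ 3 / 12))\<close> over
  the positive half-line, from the preceding formula with \<open>a = n + 1/2\<close>,
  \<open>p = 3\<close> and \<open>c = 1/12\<close>.\<close>

definition airy_moment :: "nat \<Rightarrow> real" where
  "airy_moment n = 12 powr ((n + 1/2) / 3) / 3 * Gamma ((n + 1/2) / 3)"

lemma has_integral_airy_moment:
  "((\<lambda>s. s powr (n - 1/2) * exp (- (s ^ 3 / 12))) has_integral airy_moment n) {0<..}"
proof -
  have "((\<lambda>s. s powr (real n + 1/2 - 1) * exp (- (1/12) * s ^ 3)) has_integral
      Gamma ((real n + 1/2) / real 3) / (real 3 * (1/12) powr ((real n + 1/2) / real 3))) {0<..}"
    by (rule has_integral_powr_exp) auto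
  moreover have "real n + 1/2 - 1 = n - 1/2" by simp
  ultimately show ?thesis
    by (simp add: airy_moment_def powr_divide field_simps)
qed

text \<open>The Gamma functional equation, with one extra factor 12 from the power. The factor
  \<open>4 * n + 2\<close> is the one in \<open>airy_mod_coeff_rec\<close>.\<close>

lemma airy_moment_add_3: "airy_moment (n + 3) = (4 * n + 2) * airy_moment n"
proof -
  define x where "x = (real n + 1/2) / 3"
  have x: "(real (n + 3) + 1/2) / 3 = x + 1"
    by (simp add: x_def add_divide_distrib)
  have "Gamma (x + 1) = x * Gamma x"
    by (rule Gamma_plus1) (auto simp: x_def)
  then have "airy_moment (n + 3) = 12 * x * airy_moment n"
    unfolding airy_moment_def x x_def[symmetric] by (simp add: powr_add)
  also have "12 * x = 4 * n + 2"
    by (simp add: x_def)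
  finally show ?thesis by simp
qed

section \<open>Matching the first three Taylor coefficients with the moments\<close>

lemma airy_mod_fps_0: "fps_nth airy_mod_fps 0 = 4 * airy_c1 ^ 2"
  by (simp add: airy_mod_fps_def airy_fps_def power2_eq_square algebra_simps)

lemma airy_mod_fps_1: "fps_nth airy_mod_fps 1 = 4 * airy_c1 * airy_c2"
  by (simp add: airy_mod_fps_def airy_fps_def power2_eq_square fps_mult_nth algebra_simps)

lemma airy_mod_fps_2: "fps_nth airy_mod_fps 2 = 4 * airy_c2 ^ 2"
  by (simp add: airy_mod_fps_def airy_fps_def power2_eq_square fps_mult_nth eval_nat_numeral algebra_simps)

lemma Gamma_third_pos: "Gamma (1/3::real) > 0" "Gamma (2/3::real) > 0"
  by (simp_all add: Gamma_real_pos)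

text \<open>The moment contains \<open>Gamma (1/6)\<close>. Duplication at 1/6 expresses it by
  \<open>Gamma (1/3)\<close> and \<open>Gamma (2/3)\<close>, and reflection removes
  \<open>Gamma (1/3)\<close>, leaving only what defines \<open>airy_c1\<close>.\<close>

lemma airy_moment_0: "airy_moment 0 = pi * sqrt pi * (4 * airy_c1 ^ 2)"
proof -
  have G: "Gamma (1/6) * Gamma (2/3) = 2 powr (2/3) * sqrt pi * Gamma (1/3::real)"
    using Gamma_legendre_duplication_real[of "1/6"] by simp
  have R: "Gamma (1/3) = 2 * pi / (sqrt 3 * Gamma (2/3::real))"
    using Gamma_third_reflection Gamma_third_pos[THEN less_imp_neq] by (simp add: field_simps)
  have "(12::real) powr (1/6) = 2 powr (1/3) * 3 powr (1/6)"
    using powr_mult[of 4 3 "1/6"] powr_powr[of 2 2 "1/6"] by simp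
  then have "airy_moment 0 * Gamma (2/3) = 2 powr (1/3) * 3 powr (1/6) / 3 * (Gamma (1/6) * Gamma (2/3))"
    by (simp add: airy_moment_def)
  also have "\<dots> = (2 powr (1/3) * 2 powr (2/3)) * (3 powr (1/6) / (3 * sqrt 3)) * sqrt pi * (2 * pi / Gamma (2/3::real))"
    unfolding G R by (simp add: mult_ac)
  also have "2 powr (1/3) * 2 powr (2/3) = (2::real)"
    by (simp flip: powr_add)
  also have "3 powr (1/6) / (3 * sqrt 3) = 1 / (3 powr (2/3)) ^ 2"
  proof -
    have "3 powr (1/6) * (3 powr (2/3)) ^ 2 = (3::real) powr (1/6 + 2/3 * 2)"
      by (simp add: powr_powr power2_eq_square flip: powr_add)
    also have "\<dots> = 3 powr (1 + 1/2)"
      by simp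
    also have "\<dots> = 3 * sqrt 3"
      unfolding powr_add by (simp add: powr_half_sqrt)
    finally show ?thesis
      by (simp add: field_simps)
  qed
  finally show ?thesis
    using Gamma_third_pos[THEN less_imp_neq] by (simp add: airy_c1_def field_simps power2_eq_square)
qed

lemma airy_moment_1: "airy_moment 1 = pi * sqrt pi * (4 * airy_c1 * airy_c2)"
proof -
  have "(12::real) powr (1/2) = 2 * sqrt 3"
    using real_sqrt_mult[of 4 3] by (simp add: powr_half_sqrt)
  then have "airy_moment 1 = 2 * sqrt 3 / 3 * sqrt pi"
    by (simp add: airy_moment_def Gamma_one_half_real)
  also have "\<dots> = pi * sqrt pi * (4 * (airy_c1 * airy_c2))"
    unfolding airy_c1_c2 by (simp add: field_simps)
  finally show ?thesis by simp
qed

text \<open>As for moment 0, but duplication at 1/3 handles \<open>Gamma (5/6)\<close> and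
  reflection removes \<open>Gamma (2/3)\<close>. The trailing 2 is \<open>fact 2\<close>.\<close>

lemma airy_moment_2: "airy_moment 2 = pi * sqrt pi * (4 * airy_c2 ^ 2) * 2"
proof -
  have G: "Gamma (5/6) * Gamma (1/3) = 2 powr (1/3) * sqrt pi * Gamma (2/3::real)"
    using Gamma_legendre_duplication_real[of "1/3"] by (simp add: mult.commute)
  have R: "Gamma (2/3) = 2 * pi / (sqrt 3 * Gamma (1/3::real))"
    using Gamma_third_reflection Gamma_third_pos[THEN less_imp_neq] by (simp add: field_simps)
  have "(12::real) powr (5/6) = 2 powr (5/3) * 3 powr (5/6)"
    using powr_mult[of 4 3 "5/6"] powr_powr[of 2 2 "5/6"] by simp
  then have "airy_moment 2 * Gamma (1/3) = 2 powr (5/3) * 3 powr (5/6) / 3 * (Gamma (5/6) * Gamma (1/3))"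
    by (simp add: airy_moment_def)
  also have "\<dots> = (2 powr (5/3) * 2 powr (1/3)) * (3 powr (5/6) / (3 * sqrt 3)) * sqrt pi * (2 * pi / Gamma (1/3::real))"
    unfolding G R by (simp add: mult_ac)
  also have "2 powr (5/3) * 2 powr (1/3) = (4::real)"
    by (simp flip: powr_add)
  also have "3 powr (5/6) / (3 * sqrt 3) = 1 / (3 powr (1/3)) ^ 2"
  proof -
    have "3 powr (5/6) * (3 powr (1/3)) ^ 2 = (3::real) powr (5/6 + 1/3 * 2)"
      by (simp add: powr_powr power2_eq_square flip: powr_add)
    also have "\<dots> = 3 powr (1 + 1/2)"
      by simp
    also have "\<dots> = 3 * sqrt 3"
      unfolding powr_add by (simp add: powr_half_sqrt)
    finally show ?thesis
      by (simp add: field_simps)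
  qed
  finally show ?thesis
    using Gamma_third_pos[THEN less_imp_neq] by (simp add: airy_c2_def field_simps power2_eq_square)
qed

text \<open>Both sides obey the same recursion from \<open>n\<close> to \<open>n + 3\<close> once
  the factorial is accounted for, and they agree at 0, 1 and 2.\<close>

lemma airy_mod_fps_nth: "pi * sqrt pi * fps_nth airy_mod_fps n = airy_moment n / fact n"
proof (induction n rule: less_induct)
  case (less n)
  consider "n = 0" | "n = 1" | "n = 2" | m where "n = m + 3"
    by (metis One_nat_def add.commute less_2_cases not_less_eq numeral_2_eq_2 numeral_3_eq_3 le_Suc_ex not_less less_antisym)
  then show ?case
  proof cases
    case 4
    have "pi * sqrt pi * fps_nth airy_mod_fps m = airy_moment m / fact m"
      by (rule less.IH) (use 4 in simp)
    then have "airy_moment m = pi * sqrt pi * fps_nth airy_mod_fps m * fact m"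
      by (simp add: eq_divide_eq)
    then have "airy_moment (m + 3) = pi * sqrt pi * fact m * (real (4 * m + 2) * fps_nth airy_mod_fps m)"
      by (simp add: airy_moment_add_3 algebra_simps)
    also have "\<dots> = pi * sqrt pi * fps_nth airy_mod_fps (m + 3) * fact (m + 3)"
      unfolding airy_mod_coeff_rec[symmetric] fact_add_3 by (simp add: add_ac mult_ac)
    finally show ?thesis
      unfolding 4 by simp
  next
    case 1 then show ?thesis using airy_moment_0 airy_mod_fps_0 by simp
  next
    case 2 then show ?thesis using airy_moment_1 airy_mod_fps_1 by simp
  next
    case 3 then show ?thesis using airy_moment_2 airy_mod_fps_2 by simp
  qed
qed

lemma Airy_sq_sum_sums:
  "(\<lambda>n. fps_nth airy_mod_fps n * z ^ n) sums (Airy_Ai z ^ 2 + Airy_Bi z ^ 2)"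
proof -
  let ?A = "airy_fps airy_c1 (- airy_c2)" and ?B = "airy_fps (sqrt 3 * airy_c1) (sqrt 3 * airy_c2)"
  have rA: "fps_conv_radius (?A * ?A) = \<infinity>" and rB: "fps_conv_radius (?B * ?B) = \<infinity>"
    using fps_conv_radius_mult[of ?A ?A] fps_conv_radius_mult[of ?B ?B] by (simp_all add: top.extremum_unique flip: top_ereal_def)
  then have r: "fps_conv_radius airy_mod_fps = \<infinity>"
    using fps_conv_radius_add[of "?A * ?A" "?B * ?B"]
    by (simp add: airy_mod_fps_def power2_eq_square)
  have "eval_fps airy_mod_fps z = eval_fps ?A z ^ 2 + eval_fps ?B z ^ 2"
    unfolding airy_mod_fps_def power2_eq_square
    by (simp add: eval_fps_add eval_fps_mult rA rB)
  also have "\<dots> = Airy_Ai z ^ 2 + Airy_Bi z ^ 2"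
    by (simp add: eval_airy_fps Airy_Ai_def Airy_Bi_def algebra_simps)
  finally have "(\<Sum>n. fps_nth airy_mod_fps n * z ^ n) = Airy_Ai z ^ 2 + Airy_Bi z ^ 2"
    by (simp add: eval_fps_def)
  moreover have "summable (\<lambda>n. fps_nth airy_mod_fps n * z ^ n)"
    by (rule summable_fps) (simp add: r)
  ultimately show ?thesis
    by (metis summable_sums)
qed

text \<open>Expand \<open>exp (z * s)\<close> and integrate term by term: the \<open>n\<close>-th
  term integrates to \<open>z ^ n / fact n\<close> times a moment, which by
  \<open>airy_mod_fps_nth\<close> is a term of the series of \<open>Ai ^ 2 + Bi ^ 2\<close>.\<close>

lemma Airy_sq_sum_integral:
  "((\<lambda>s. exp (z * s - s ^ 3 / 12) / sqrt s) has_integral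
      pi * sqrt pi * (Airy_Ai z ^ 2 + Airy_Bi z ^ 2)) {0<..}"
proof -
  define w where "w n s = s powr (real n - 1/2) * exp (- (s ^ 3 / 12))" for n and s :: real
  have w_int: "(w n has_integral airy_moment n) {0<..}" for n
    unfolding w_def using has_integral_airy_moment by simp
  have w_nonneg: "w n s \<ge> 0" for n s
    by (simp add: w_def)
  have "w n absolutely_integrable_on {0<..}" for n
    by (intro nonnegative_absolutely_integrable_1) (use w_int w_nonneg in \<open>auto simp: has_integral_integrable\<close>)
  then have w_si: "set_integrable lebesgue {0<..} (\<lambda>s. z ^ n / fact n * w n s)" for n z
    by (intro set_integrable_mult_right) auto
  have w_lint: "(LINT s:{0<..}|lebesgue. z ^ n / fact n * w n s) = z ^ n / fact n * airy_moment n" for n z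
    by (rule trans[OF set_lebesgue_integral_eq_integral(2)[OF w_si] integral_unique[OF has_integral_mult_right[OF w_int]]])
  let ?f = "\<lambda>z n s. indicator {0<..} s *\<^sub>R (z ^ n / fact n * w n s)"
  have sum: "(\<lambda>n. ?f z n s) sums (indicator {0<..} s *\<^sub>R (exp (z * s - s ^ 3 / 12) / sqrt s))" for z s
  proof (cases "s > 0")
    case True
    have lim: "(\<lambda>n. (z * s) ^ n /\<^sub>R fact n * (s powr (- (1/2)) * exp (- (s ^ 3 / 12)))) sums
        (exp (z * s) * (s powr (- (1/2)) * exp (- (s ^ 3 / 12))))"
      by (intro sums_mult2 exp_converges)
    have "s powr (real n - 1/2) = s ^ n * s powr (- (1/2))" for n
      using True powr_add[of s "real n" "- (1/2)"] by (simp add: powr_realpow)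
    then have "(z * s) ^ n /\<^sub>R fact n * (s powr (- (1/2)) * exp (- (s ^ 3 / 12))) = ?f z n s" for n
      using True by (simp add: w_def power_mult_distrib inverse_eq_divide)
    moreover have "exp (z * s) * (s powr (- (1/2)) * exp (- (s ^ 3 / 12)))
        = indicator {0<..} s *\<^sub>R (exp (z * s - s ^ 3 / 12) / sqrt s)"
    proof -
      have "exp (z * s - s ^ 3 / 12) = exp (z * s) * exp (- (s ^ 3 / 12))"
        by (simp flip: exp_add)
      then show ?thesis
        using True by (simp add: powr_minus_divide powr_half_sqrt)
    qed
    ultimately show ?thesis
      using lim by (simp only:)
  qed simp
  have coeff: "z ^ n / fact n * airy_moment n = pi * sqrt pi * (fps_nth airy_mod_fps n * z ^ n)" for z n
    using airy_mod_fps_nth[of n] by (simp add: field_simps)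
  \<comment> \<open>As \<open>w\<close> is nonnegative, taking norms amounts to replacing
    \<open>z\<close> by \<open>\<bar>z\<bar>\<close>; the same device bounds the integrals of the
    norms, by the entire series at \<open>\<bar>z\<bar>\<close>.\<close>
  have sm1: "summable (\<lambda>n. norm (?f z n s))" for s
    using sums_summable[OF sum[where z = "\<bar>z\<bar>" and s = s]] by (simp add: abs_mult power_abs w_nonneg)
  have sm2: "summable (\<lambda>n. LINT s|lebesgue. norm (?f z n s))"
  proof -
    have "(LINT s|lebesgue. norm (?f z n s)) = pi * sqrt pi * (fps_nth airy_mod_fps n * \<bar>z\<bar> ^ n)" for n
    proof -
      have "(LINT s|lebesgue. norm (?f z n s)) = (LINT s:{0<..}|lebesgue. \<bar>z\<bar> ^ n / fact n * w n s)"
        unfolding set_lebesgue_integral_def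
        by (intro Bochner_Integration.integral_cong refl) (simp add: abs_mult power_abs w_nonneg)
      then show ?thesis
        by (simp only: w_lint coeff)
    qed
    then show ?thesis
      using sums_summable[OF Airy_sq_sum_sums[of "\<bar>z\<bar>"]] by (simp add: summable_mult)
  qed
  have int: "integrable lebesgue (?f z n)" for n
    using w_si unfolding set_integrable_def .
  have I: "integrable lebesgue (\<lambda>s. \<Sum>n. ?f z n s)"
    by (rule integrable_suminf[OF int AE_I2[OF sm1] sm2])
  have S: "(\<lambda>n. LINT s|lebesgue. ?f z n s) sums (LINT s|lebesgue. (\<Sum>n. ?f z n s))"
    by (rule sums_integral[OF int AE_I2[OF sm1] sm2])
  have eq: "(\<Sum>n. ?f z n s) = indicator {0<..} s *\<^sub>R (exp (z * s - s ^ 3 / 12) / sqrt s)" for s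
    using sum[where z = z and s = s] by (simp add: sums_iff)
  have "(\<lambda>n. LINT s|lebesgue. ?f z n s) sums (pi * sqrt pi * (Airy_Ai z ^ 2 + Airy_Bi z ^ 2))"
    using sums_mult[OF Airy_sq_sum_sums[of z]] by (simp only: w_lint[of z, unfolded set_lebesgue_integral_def] coeff)
  then have "(LINT s:{0<..}|lebesgue. exp (z * s - s ^ 3 / 12) / sqrt s) = pi * sqrt pi * (Airy_Ai z ^ 2 + Airy_Bi z ^ 2)"
    using S unfolding set_lebesgue_integral_def eq by (rule sums_unique2[symmetric])
  moreover have "set_integrable lebesgue {0<..} (\<lambda>s. exp (z * s - s ^ 3 / 12) / sqrt s)"
    using I unfolding set_integrable_def eq .
  ultimately show ?thesis
    by (metis has_integral_set_lebesgue)
qed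

text \<open>In the Laplace integral at \<open>z = - t\<close>, the factor
  \<open>exp (- (s ^ 3 / 12))\<close> lies between \<open>1 - s ^ 3 / 12\<close> and 1. Either
  replacement leaves elementary Gamma integrals.\<close>

lemma Airy_sq_sum_bounds:
  assumes "t > 0"
  shows "pi * sqrt t * (Airy_Ai (- t) ^ 2 + Airy_Bi (- t) ^ 2) \<le> 1"
    and "pi * sqrt t * (Airy_Ai (- t) ^ 2 + Airy_Bi (- t) ^ 2) \<ge> 1 - Gamma (7/2) / (12 * sqrt pi * t ^ 3)"
proof -
  define M where "M = Airy_Ai (- t) ^ 2 + Airy_Bi (- t) ^ 2"
  have I: "((\<lambda>s. exp (- t * s - s ^ 3 / 12) / sqrt s) has_integral pi * sqrt pi * M) {0<..}"
    unfolding M_def by (rule Airy_sq_sum_integral)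
  have "((\<lambda>s. s powr (1/2 - 1) * exp (- t * s ^ 1)) has_integral Gamma ((1/2) / real 1) / (real 1 * t powr ((1/2) / real 1))) {0<..}"
    by (rule has_integral_powr_exp) (use assms in auto)
  then have G1: "((\<lambda>s. s powr (- (1/2)) * exp (- t * s)) has_integral sqrt pi / sqrt t) {0<..}"
    using assms by (simp add: Gamma_one_half_real powr_half_sqrt)
  \<comment> \<open>The correction \<open>s ^ 3\<close> times the weight
    \<open>s powr (- (1/2))\<close> is \<open>s powr (5/2)\<close>, hence the parameter 7/2.\<close>
  have "((\<lambda>s. s powr (7/2 - 1) * exp (- t * s ^ 1)) has_integral Gamma ((7/2) / real 1) / (real 1 * t powr ((7/2) / real 1))) {0<..}"
    by (rule has_integral_powr_exp) (use assms in auto)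
  moreover have "t powr (7/2) = t ^ 3 * sqrt t"
    using assms powr_add[of t 3 "1/2"] by (simp add: powr_half_sqrt)
  ultimately have G2: "((\<lambda>s. s powr (5/2) * exp (- t * s)) has_integral Gamma (7/2) / (t ^ 3 * sqrt t)) {0<..}"
    by simp
  have eq: "exp (- t * s - s ^ 3 / 12) / sqrt s = s powr (- (1/2)) * exp (- t * s) * exp (- (s ^ 3 / 12))" if "s > 0" for s
  proof -
    have "exp (- t * s - s ^ 3 / 12) = exp (- t * s) * exp (- (s ^ 3 / 12))"
      by (simp flip: exp_add)
    then show ?thesis
      using that by (simp add: powr_minus_divide powr_half_sqrt)
  qed
  have "pi * sqrt pi * M \<le> sqrt pi / sqrt t"
  proof (rule has_integral_le[OF I G1])
    fix s :: real assume "s \<in> {0<..}"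
    then show "exp (- t * s - s ^ 3 / 12) / sqrt s \<le> s powr (- (1/2)) * exp (- t * s)"
      by (subst eq) (auto intro!: mult_left_le)
  qed
  then show "pi * sqrt t * M \<le> 1"
    using assms by (simp add: field_simps)
  have "sqrt pi / sqrt t - Gamma (7/2) / (t ^ 3 * sqrt t) / 12 \<le> pi * sqrt pi * M"
  proof (rule has_integral_le[OF has_integral_diff[OF G1 has_integral_divide[OF G2]] I])
    fix s :: real assume "s \<in> {0<..}"
    then have s: "s > 0" by simp
    have "s powr (5/2) = s powr (- (1/2)) * s ^ 3"
      using s powr_add[of s "- (1/2)" 3] by simp
    then have "s powr (- (1/2)) * exp (- t * s) - s powr (5/2) * exp (- t * s) / 12
        = s powr (- (1/2)) * exp (- t * s) * (1 - s ^ 3 / 12)"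
      by (simp add: algebra_simps)
    also have "\<dots> \<le> s powr (- (1/2)) * exp (- t * s) * exp (- (s ^ 3 / 12))"
      using exp_ge_add_one_self[of "- (s ^ 3 / 12)"] by (intro mult_left_mono) auto
    finally show "s powr (- (1/2)) * exp (- t * s) - s powr (5/2) * exp (- t * s) / 12
        \<le> exp (- t * s - s ^ 3 / 12) / sqrt s"
      using eq[OF s] by simp
  qed
  then have "(sqrt pi / sqrt t - Gamma (7/2) / (t ^ 3 * sqrt t) / 12) * (sqrt t / sqrt pi) \<le> pi * sqrt pi * M * (sqrt t / sqrt pi)"
    using assms by (intro mult_right_mono) auto
  also have "pi * sqrt pi * M * (sqrt t / sqrt pi) = pi * sqrt t * M"
    by simp
  also have "(sqrt pi / sqrt t - Gamma (7/2) / (t ^ 3 * sqrt t) / 12) * (sqrt t / sqrt pi) = 1 - Gamma (7/2) / (12 * sqrt pi * t ^ 3)"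
    using assms by (simp add: left_diff_distrib) (simp add: diff_divide_distrib mult_ac)
  finally show "1 - Gamma (7/2) / (12 * sqrt pi * t ^ 3) \<le> pi * sqrt t * M" .
qed

subsection \<open>The phase of the reference solution\<close>

lemma Airy_Ai_has_field_derivative:
  "(Airy_Ai has_field_derivative eval_fps (fps_deriv (airy_fps airy_c1 (- airy_c2))) x) (at x)"
proof -
  have "Airy_Ai = eval_fps (airy_fps airy_c1 (- airy_c2))"
    by (simp add: fun_eq_iff eval_airy_fps Airy_Ai_def)
  then show ?thesis
    using has_field_derivative_eval_fps[of x "airy_fps airy_c1 (- airy_c2)" UNIV] by simp
qed

lemma Airy_Bi_has_field_derivative:
  "(Airy_Bi has_field_derivative eval_fps (fps_deriv (airy_fps (sqrt 3 * airy_c1) (sqrt 3 * airy_c2))) x) (at x)"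
proof -
  have "Airy_Bi = eval_fps (airy_fps (sqrt 3 * airy_c1) (sqrt 3 * airy_c2))"
    by (simp add: fun_eq_iff eval_airy_fps Airy_Bi_def algebra_simps)
  then show ?thesis
    using has_field_derivative_eval_fps[of x "airy_fps (sqrt 3 * airy_c1) (sqrt 3 * airy_c2)" UNIV] by simp
qed

lemma Airy_deriv2:
  "(deriv Airy_Ai has_field_derivative x * Airy_Ai x) (at x)"
  "(deriv Airy_Bi has_field_derivative x * Airy_Bi x) (at x)"
proof -
  have *: "(eval_fps (fps_deriv (airy_fps p q)) has_field_derivative x * (p * airy_f x + q * airy_g x)) (at x)" for p q
  proof -
    have r: "fps_conv_radius (fps_deriv (airy_fps p q)) = \<infinity>"
      using fps_conv_radius_deriv[of "airy_fps p q"] by simp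
    have "eval_fps (fps_deriv (fps_deriv (airy_fps p q))) x = x * (p * airy_f x + q * airy_g x)"
      unfolding airy_fps_deriv2 by (simp add: eval_fps_mult eval_airy_fps)
    then show ?thesis
      using has_field_derivative_eval_fps[of x "fps_deriv (airy_fps p q)" UNIV] by (simp add: r)
  qed
  have "deriv Airy_Ai = eval_fps (fps_deriv (airy_fps airy_c1 (- airy_c2)))"
    using DERIV_imp_deriv[OF Airy_Ai_has_field_derivative] by blast
  then show "(deriv Airy_Ai has_field_derivative x * Airy_Ai x) (at x)"
    using *[of airy_c1 "- airy_c2"] by (simp add: Airy_Ai_def)
  have "deriv Airy_Bi = eval_fps (fps_deriv (airy_fps (sqrt 3 * airy_c1) (sqrt 3 * airy_c2)))"
    using DERIV_imp_deriv[OF Airy_Bi_has_field_derivative] by blast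
  then show "(deriv Airy_Bi has_field_derivative x * Airy_Bi x) (at x)"
    using *[of "sqrt 3 * airy_c1" "sqrt 3 * airy_c2"] by (simp add: Airy_Bi_def algebra_simps)
qed

lemma Airy_has_deriv:
  "(Airy_Ai has_field_derivative deriv Airy_Ai x) (at x)"
  "(Airy_Bi has_field_derivative deriv Airy_Bi x) (at x)"
  using Airy_Ai_has_field_derivative Airy_Bi_has_field_derivative
  by (metis DERIV_imp_deriv)+

text \<open>Both functions solve \<open>y'' = x * y\<close>, so the Wronskian has derivative 0; its
  value at 0 is \<open>2 * sqrt 3 * airy_c1 * airy_c2\<close>.\<close>

lemma Airy_Wronskian: "Airy_Ai x * deriv Airy_Bi x - deriv Airy_Ai x * Airy_Bi x = 1 / pi"
proof -
  define W where "W x = Airy_Ai x * deriv Airy_Bi x - deriv Airy_Ai x * Airy_Bi x" for x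
  have "(W has_field_derivative 0) (at x)" for x
    unfolding W_def by (auto intro!: derivative_eq_intros Airy_has_deriv Airy_deriv2)
  then have "W x = W 0"
    using DERIV_isconst_all by blast
  also have "\<dots> = 2 * sqrt 3 * (airy_c1 * airy_c2)"
  proof -
    have "airy_f 0 = 1" "airy_g 0 = 0"
      using eval_airy_fps[of 1 0 0] eval_airy_fps[of 0 1 0]
      by (simp_all add: eval_fps_at_0 airy_fps_def)
    moreover have "deriv Airy_Ai 0 = - airy_c2"
      using DERIV_imp_deriv[OF Airy_Ai_has_field_derivative[of 0]]
      by (simp add: eval_fps_at_0 airy_fps_def)
    moreover have "deriv Airy_Bi 0 = sqrt 3 * airy_c2"
      using DERIV_imp_deriv[OF Airy_Bi_has_field_derivative[of 0]]
      by (simp add: eval_fps_at_0 airy_fps_def)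
    ultimately show ?thesis
      by (simp add: W_def Airy_Ai_def Airy_Bi_def)
  qed
  also have "\<dots> = 1 / pi"
    unfolding airy_c1_c2 by simp
  finally show ?thesis
    by (simp add: W_def)
qed

section \<open>Modulus, derivative and phase of the reference solution\<close>

definition ref_arg :: "real \<Rightarrow> real \<Rightarrow> real \<Rightarrow> real" where
  "ref_arg F E x = - (F powr (1/3)) * (x + E / F)"

lemma norm_ref_zeta_sq:
  "(norm (ref_zeta F E x))\<^sup>2 = pi / F powr (1/3) * (Airy_Ai (ref_arg F E x) ^ 2 + Airy_Bi (ref_arg F E x) ^ 2)"
proof -
  have "(norm (\<i> * complex_of_real (Airy_Ai (ref_arg F E x)) + complex_of_real (Airy_Bi (ref_arg F E x))))\<^sup>2
      = Airy_Ai (ref_arg F E x) ^ 2 + Airy_Bi (ref_arg F E x) ^ 2"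
    by (simp add: cmod_power2)
  then show ?thesis
    unfolding ref_zeta_def ref_arg_def[symmetric] norm_mult power_mult_distrib by simp
qed

text \<open>A zero would be a common zero of Ai and Bi, making their Wronskian vanish there.\<close>

lemma ref_zeta_nonzero:
  assumes "F > 0"
  shows "ref_zeta F E x \<noteq> 0"
proof
  assume "ref_zeta F E x = 0"
  then have "Airy_Ai (ref_arg F E x) = 0" "Airy_Bi (ref_arg F E x) = 0"
    using norm_ref_zeta_sq[of F E x] assms by (simp_all add: sum_power2_eq_zero_iff)
  then show False
    using Airy_Wronskian[of "ref_arg F E x"] by simp
qed

text \<open>The imaginary part is \<open>pi / a\<close> from the prefactors, times \<open>a\<close>
  from the chain rule, times the Wronskian \<open>1 / pi\<close>. The minus sign of the inner
  derivative is absorbed because Ai is the imaginary component.\<close>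

lemma ref_zeta_has_vector_derivative:
  obtains D where "(ref_zeta F E has_vector_derivative D) (at x)" "F > 0 \<Longrightarrow> Im (D * cnj (ref_zeta F E x)) = 1"
proof -
  define a where "a = F powr (1/3)"
  define z where "z = ref_arg F E x"
  define D where "D = complex_of_real (sqrt (pi / a)) *
      (\<i> * of_real (- a * deriv Airy_Ai z) + of_real (- a * deriv Airy_Bi z))"
  have arg: "(ref_arg F E has_field_derivative - a) (at x)"
    unfolding ref_arg_def a_def by (auto intro!: derivative_eq_intros)
  have "((\<lambda>x. Airy_Ai (ref_arg F E x)) has_real_derivative - a * deriv Airy_Ai z) (at x)"
       "((\<lambda>x. Airy_Bi (ref_arg F E x)) has_real_derivative - a * deriv Airy_Bi z) (at x)"
    unfolding z_def
    using DERIV_chain2[OF Airy_has_deriv(1) arg] DERIV_chain2[OF Airy_has_deriv(2) arg]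
    by (simp_all only: mult.commute)
  then have D: "(ref_zeta F E has_vector_derivative D) (at x)"
    unfolding ref_zeta_def D_def a_def ref_arg_def[symmetric]
    by (intro derivative_intros has_vector_derivative_mult_right has_vector_derivative_of_real)
  have "Im (D * cnj (ref_zeta F E x)) = 1" if "F > 0"
  proof -
    have a: "a > 0" using that by (simp add: a_def)
    have "ref_zeta F E x = complex_of_real (sqrt (pi / a)) * (\<i> * of_real (Airy_Ai z) + of_real (Airy_Bi z))"
      by (simp add: ref_zeta_def a_def z_def ref_arg_def)
    then have "Im (D * cnj (ref_zeta F E x)) = sqrt (pi / a) * sqrt (pi / a) * a * (Airy_Ai z * deriv Airy_Bi z - deriv Airy_Ai z * Airy_Bi z)"
      by (simp add: D_def algebra_simps)
    also have "sqrt (pi / a) * sqrt (pi / a) = pi / a"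
      using a by simp
    finally show ?thesis
      unfolding Airy_Wronskian using a by simp
  qed
  with D show thesis by (rule that)
qed

text \<open>Near \<open>x\<close> the phase is \<gamma> at \<open>x\<close> plus the imaginary part
  of a principal logarithm of \<open>q\<close>, so continuity of \<gamma> already yields
  differentiability.\<close>

lemma phase_has_derivative:
  fixes \<gamma> :: "real \<Rightarrow> real" and \<zeta> :: "real \<Rightarrow> complex"
  assumes cont: "continuous_on UNIV \<gamma>"
    and phase: "\<And>x. \<zeta> x = of_real (cmod (\<zeta> x)) * exp (\<i> * of_real (\<gamma> x))"
    and nz: "\<And>x. \<zeta> x \<noteq> 0"
    and der: "(\<zeta> has_vector_derivative D) (at x)"
  shows "(\<gamma> has_field_derivative Im (D / \<zeta> x)) (at x)"
proof -
  \<comment> \<open>Normalising to \<open>q x = 1\<close> keeps the argument of \<open>Ln\<close>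
    off its branch cut near \<open>x\<close>.\<close>
  define q where "q y = \<zeta> y / \<zeta> x" for y
  have q: "(q has_vector_derivative D / \<zeta> x) (at x)"
    unfolding q_def using has_vector_derivative_divide[OF der] by simp
  have "(Ln has_field_derivative inverse (q x)) (at (q x))"
    by (rule has_field_derivative_Ln) (simp add: q_def nz)
  moreover have "q x = 1"
    by (simp add: q_def nz)
  ultimately have "((Ln \<circ> q) has_vector_derivative D / \<zeta> x) (at x)"
    using field_vector_diff_chain_at[OF q, of Ln 1] by simp
  then have Im: "((\<lambda>y. Im (Ln (q y))) has_vector_derivative Im (D / \<zeta> x)) (at x)"
    using bounded_linear.has_vector_derivative[OF bounded_linear_Im] unfolding o_def by blast
  then have "((\<lambda>y. Im (Ln (q y))) has_field_derivative Im (D / \<zeta> x)) (at x)"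
    by (simp only: has_real_derivative_iff_has_vector_derivative)
  then have *: "((\<lambda>y. \<gamma> x + Im (Ln (q y))) has_field_derivative Im (D / \<zeta> x)) (at x)"
    using DERIV_add[OF DERIV_const[of "\<gamma> x"]] by fastforce
  have "isCont \<gamma> x"
    using cont by (simp add: continuous_on_eq_continuous_at)
  then have "(\<gamma> \<longlongrightarrow> \<gamma> x) (nhds x)"
    by (simp only: isCont_def tendsto_at_iff_tendsto_nhds)
  \<comment> \<open>The bound \<open>pi\<close> puts the phase difference inside the strip where
    \<open>Ln\<close> inverts \<open>exp\<close>, which excludes jumps by multiples of
    \<open>2 * pi\<close>.\<close>
  then have "\<forall>\<^sub>F y in nhds x. dist (\<gamma> y) (\<gamma> x) < pi"
    by (rule tendstoD) simp
  then have "\<forall>\<^sub>F y in nhds x. \<gamma> y = \<gamma> x + Im (Ln (q y))"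
  proof eventually_elim
    case (elim y)
    have "q y = of_real (cmod (\<zeta> y) / cmod (\<zeta> x)) * exp (\<i> * of_real (\<gamma> y - \<gamma> x))"
      unfolding q_def using arg_cong2[where f = "(/)", OF phase[of y] phase[of x]]
      by (simp add: exp_diff right_diff_distrib)
    also have "\<dots> = exp (of_real (ln (cmod (\<zeta> y) / cmod (\<zeta> x))) + \<i> * of_real (\<gamma> y - \<gamma> x))"
      using nz by (simp only: exp_add exp_of_real exp_ln divide_pos_pos zero_less_norm_iff not_False_eq_True)
    also have "Ln \<dots> = of_real (ln (cmod (\<zeta> y) / cmod (\<zeta> x))) + \<i> * of_real (\<gamma> y - \<gamma> x)"
      by (rule Ln_exp) (use elim in \<open>auto simp: dist_real_def\<close>)
    finally show ?case by simp
  qed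
  then show ?thesis
    using * DERIV_cong_ev[OF refl _ refl, of \<gamma> "\<lambda>y. \<gamma> x + Im (Ln (q y))" x] by simp
qed

lemma phase_deriv:
  fixes \<gamma> :: "real \<Rightarrow> real"
  assumes F: "F > 0" and cont: "continuous_on UNIV \<gamma>"
    and phase: "\<And>x. ref_zeta F E x = of_real (cmod (ref_zeta F E x)) * exp (\<i> * of_real (\<gamma> x))"
  shows "(\<gamma> has_field_derivative 1 / (norm (ref_zeta F E x))\<^sup>2) (at x)"
proof -
  obtain D where D: "(ref_zeta F E has_vector_derivative D) (at x)"
    and Im: "Im (D * cnj (ref_zeta F E x)) = 1"
    using ref_zeta_has_vector_derivative F by metis
  have "D / ref_zeta F E x = D * cnj (ref_zeta F E x) / of_real ((norm (ref_zeta F E x))\<^sup>2)"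
    by (rule complex_div_cnj)
  then have "Im (D / ref_zeta F E x) = 1 / (norm (ref_zeta F E x))\<^sup>2"
    by (simp only: Im_divide_of_real Im)
  then show ?thesis
    using phase_has_derivative[OF cont phase ref_zeta_nonzero[OF F] D] by simp
qed

section \<open>Asymptotics of the phase derivative\<close>

lemma norm_ref_zeta_sq_bounds:
  assumes F: "F > 0"
  obtains C where "\<And>x. F * x + E > 0 \<Longrightarrow> sqrt (F * x + E) * (norm (ref_zeta F E x))\<^sup>2 \<le> 1"
    and "\<And>x. F * x + E > 0 \<Longrightarrow> sqrt (F * x + E) * (norm (ref_zeta F E x))\<^sup>2 \<ge> 1 - C / (F * x + E) ^ 3"
proof -
  define a where "a = F powr (1/3)"
  have a: "a > 0" and a3: "a ^ 3 = F"
    using F by (auto simp: a_def powr_powr simp flip: powr_realpow)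
  \<comment> \<open>With \<open>F * x + E = a ^ 2 * t\<close>, replacing \<open>t ^ 3\<close> by
    \<open>(F * x + E) ^ 3\<close> costs \<open>a ^ 6\<close>, which is
    \<open>F ^ 2\<close>.\<close>
  define C where "C = Gamma (7/2) / (12 * sqrt pi) * F ^ 2"
  have *: "sqrt (F * x + E) * (norm (ref_zeta F E x))\<^sup>2 \<le> 1
      \<and> sqrt (F * x + E) * (norm (ref_zeta F E x))\<^sup>2 \<ge> 1 - C / (F * x + E) ^ 3"
    if "F * x + E > 0" for x
  proof -
    define t where "t = a * (x + E / F)"
    have Ft: "F * x + E = a ^ 2 * t"
      using F a3 by (simp add: t_def power3_eq_cube power2_eq_square field_simps)
    then have t: "t > 0"
      using that a by (simp add: zero_less_mult_iff)
    have "ref_arg F E x = - t"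
      by (simp add: ref_arg_def t_def a_def)
    then have N: "(norm (ref_zeta F E x))\<^sup>2 = pi / a * (Airy_Ai (- t) ^ 2 + Airy_Bi (- t) ^ 2)"
      by (simp add: norm_ref_zeta_sq a_def)
    have "sqrt (F * x + E) = a * sqrt t"
      using a by (simp add: Ft real_sqrt_mult)
    then have "sqrt (F * x + E) * (norm (ref_zeta F E x))\<^sup>2 = pi * sqrt t * (Airy_Ai (- t) ^ 2 + Airy_Bi (- t) ^ 2)"
      using a by (simp add: N)
    moreover have "C / (F * x + E) ^ 3 = Gamma (7/2) / (12 * sqrt pi * t ^ 3)"
    proof -
      have "(F * x + E) ^ 3 = (a ^ 3) ^ 2 * t ^ 3"
        unfolding Ft by (simp add: power_mult_distrib flip: power_mult)
      then show ?thesis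
        using F by (simp add: C_def a3)
    qed
    ultimately show ?thesis
      using Airy_sq_sum_bounds[OF t] by simp
  qed
  then show thesis
    using that by blast
qed

lemma phase_deriv_asymp:
  assumes F: "F > 0"
  shows "((\<lambda>x. 1 / (norm (ref_zeta F E x))\<^sup>2 - sqrt (F * x)) \<longlongrightarrow> 0) at_top"
    and "((\<lambda>x. ((norm (ref_zeta F E x))\<^sup>2)\<^sup>2 * x) \<longlongrightarrow> 1 / F) at_top"
proof -
  obtain C where up: "\<And>x. F * x + E > 0 \<Longrightarrow> sqrt (F * x + E) * (norm (ref_zeta F E x))\<^sup>2 \<le> 1"
    and lo: "\<And>x. F * x + E > 0 \<Longrightarrow> sqrt (F * x + E) * (norm (ref_zeta F E x))\<^sup>2 \<ge> 1 - C / (F * x + E) ^ 3"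
    using norm_ref_zeta_sq_bounds[OF F, of E] by blast
  define n where "n x = (norm (ref_zeta F E x))\<^sup>2" for x
  define r where "r x = sqrt (F * x + E) * n x" for x
  have n_pos: "n x > 0" for x
    using ref_zeta_nonzero[OF F] by (simp add: n_def)
  have pos: "\<forall>\<^sub>F x in at_top. F * x + E > 0"
    using F by real_asymp
  have r_lim: "(r \<longlongrightarrow> 1) at_top"
  proof (rule tendsto_sandwich)
    show "\<forall>\<^sub>F x in at_top. 1 - C / (F * x + E) ^ 3 \<le> r x"
      using pos by eventually_elim (simp add: lo r_def n_def)
    show "\<forall>\<^sub>F x in at_top. r x \<le> 1"
      using pos by eventually_elim (simp add: up r_def n_def)
    have "((\<lambda>x. 1 / (F * x + E) ^ 3) \<longlongrightarrow> 0) at_top"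
      using F by real_asymp
    from tendsto_diff[OF tendsto_const[of 1] tendsto_mult_right_zero[OF this, of C]]
    show "((\<lambda>x. 1 - C / (F * x + E) ^ 3) \<longlongrightarrow> 1) at_top"
      by simp
  qed simp
  \<comment> \<open>Convergence of \<open>r\<close> to 1 would not suffice against the growing
    square root; the cubic rate in the lower bound does.\<close>
  have d_lim: "((\<lambda>x. sqrt (F * x + E) * (1 - r x)) \<longlongrightarrow> 0) at_top"
  proof (rule tendsto_sandwich)
    show "\<forall>\<^sub>F x in at_top. 0 \<le> sqrt (F * x + E) * (1 - r x)"
      using pos by eventually_elim (simp add: up r_def n_def)
    show "\<forall>\<^sub>F x in at_top. sqrt (F * x + E) * (1 - r x) \<le> sqrt (F * x + E) * (C / (F * x + E) ^ 3)"
      using pos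
    proof eventually_elim
      case (elim x)
      have "1 - r x \<le> C / (F * x + E) ^ 3"
        using lo[OF elim] by (simp add: r_def n_def)
      then show ?case
        using elim by (intro mult_left_mono) auto
    qed
    have "((\<lambda>x. sqrt (F * x + E) * (1 / (F * x + E) ^ 3)) \<longlongrightarrow> 0) at_top"
      using F by real_asymp
    from tendsto_mult_right_zero[OF this, of C]
    show "((\<lambda>x. sqrt (F * x + E) * (C / (F * x + E) ^ 3)) \<longlongrightarrow> 0) at_top"
      by (simp add: mult_ac)
  qed simp
  \<comment> \<open>The first summand is \<open>1 / n x - sqrt (F * x + E)\<close>, since
    \<open>sqrt (F * x + E) / r x = 1 / n x\<close>; the second removes the shift by
    \<open>E\<close> and is rationalised below.\<close>
  have "((\<lambda>x. sqrt (F * x + E) * (1 - r x) / r x + (sqrt (F * x + E) - sqrt (F * x))) \<longlongrightarrow> 0 / 1 + 0) at_top"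
  proof (intro tendsto_add tendsto_divide d_lim r_lim)
    have "((\<lambda>x. 1 / (sqrt (F * x + E) + sqrt (F * x))) \<longlongrightarrow> 0) at_top"
      using F by real_asymp
    then have "((\<lambda>x. E * (1 / (sqrt (F * x + E) + sqrt (F * x)))) \<longlongrightarrow> 0) at_top"
      by (rule tendsto_mult_right_zero)
    moreover have "\<forall>\<^sub>F x in at_top. E * (1 / (sqrt (F * x + E) + sqrt (F * x))) = sqrt (F * x + E) - sqrt (F * x)"
      using pos eventually_gt_at_top[of 0]
    proof eventually_elim
      case (elim x)
      then have "(sqrt (F * x + E) - sqrt (F * x)) * (sqrt (F * x + E) + sqrt (F * x)) = E"
        using F by (simp add: algebra_simps)
      moreover have "sqrt (F * x + E) + sqrt (F * x) > 0"
        using elim F by (intro add_pos_pos) auto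
      ultimately show ?case
        by (simp add: field_simps)
    qed
    ultimately show "((\<lambda>x. sqrt (F * x + E) - sqrt (F * x)) \<longlongrightarrow> 0) at_top"
      by (simp add: tendsto_cong)
  qed simp
  moreover have "\<forall>\<^sub>F x in at_top. sqrt (F * x + E) * (1 - r x) / r x + (sqrt (F * x + E) - sqrt (F * x)) = 1 / n x - sqrt (F * x)"
    using pos
  proof eventually_elim
    case (elim x)
    then have "r x > 0" "sqrt (F * x + E) / r x = 1 / n x"
      using n_pos[of x] by (auto simp: r_def)
    then show ?case
      by (simp add: right_diff_distrib diff_divide_distrib)
  qed
  ultimately show "((\<lambda>x. 1 / (norm (ref_zeta F E x))\<^sup>2 - sqrt (F * x)) \<longlongrightarrow> 0) at_top"
    by (simp add: tendsto_cong n_def)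
  have "((\<lambda>x. (r x)\<^sup>2 * (x / (F * x + E))) \<longlongrightarrow> 1\<^sup>2 * (1 / F)) at_top"
  proof (intro tendsto_mult tendsto_power r_lim)
    show "((\<lambda>x. x / (F * x + E)) \<longlongrightarrow> 1 / F) at_top"
      unfolding inverse_eq_divide [symmetric] using F by real_asymp
  qed
  moreover have "\<forall>\<^sub>F x in at_top. (r x)\<^sup>2 * (x / (F * x + E)) = (n x)\<^sup>2 * x"
    using pos by eventually_elim (simp add: r_def power_mult_distrib)
  ultimately show "((\<lambda>x. ((norm (ref_zeta F E x))\<^sup>2)\<^sup>2 * x) \<longlongrightarrow> 1 / F) at_top"
    by (simp add: tendsto_cong n_def)
qed

text \<open>On each unit interval the mean value theorem gives \<gamma>' at an intermediate point,
  where it is \<open>sqrt (F * j) + o(1)\<close>. Induction adds \<open>k\<close> such steps, each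
  also moving the base point from \<open>j + k\<close> back to \<open>j\<close> at cost
  \<open>o(1)\<close>.\<close>

lemma phase_increment:
  fixes \<gamma> \<gamma>' :: "real \<Rightarrow> real"
  assumes F: "F > 0"
    and der: "\<And>x. (\<gamma> has_field_derivative \<gamma>' x) (at x)"
    and lim: "((\<lambda>x. \<gamma>' x - sqrt (F * x)) \<longlongrightarrow> 0) at_top"
  shows "(\<lambda>j. \<gamma> (real (j + k)) - \<gamma> (real j) - real k * sqrt (F * real j)) \<longlonglongrightarrow> 0"
proof (induction k)
  case (Suc k)
  have "\<forall>j. \<exists>\<xi>. real j < \<xi> \<and> \<xi> < real j + 1 \<and> \<gamma> (real j + 1) - \<gamma> (real j) = \<gamma>' \<xi>"
    using MVT2[OF _ der] by (metis add_diff_cancel_left' less_add_one mult_1)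
  then obtain \<xi> where \<xi>: "\<And>j::nat. real j < \<xi> j" "\<And>j. \<xi> j < real j + 1"
    "\<And>j. \<gamma> (real j + 1) - \<gamma> (real j) = \<gamma>' (\<xi> j)"
    by metis
  have "filterlim \<xi> at_top sequentially"
    by (rule filterlim_at_top_mono[OF filterlim_real_sequentially]) (simp add: \<xi> less_imp_le)
  with lim have 1: "(\<lambda>j. \<gamma>' (\<xi> j) - sqrt (F * \<xi> j)) \<longlonglongrightarrow> 0"
    by (rule filterlim_compose)
  have 2: "(\<lambda>j. sqrt (F * \<xi> j) - sqrt (F * real j)) \<longlonglongrightarrow> 0"
  proof (rule tendsto_sandwich)
    show "\<forall>\<^sub>F j in sequentially. 0 \<le> sqrt (F * \<xi> j) - sqrt (F * real j)"
      using F by (simp add: \<xi> less_imp_le)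
    show "\<forall>\<^sub>F j in sequentially. sqrt (F * \<xi> j) - sqrt (F * real j) \<le> sqrt (F * (real j + 1)) - sqrt (F * real j)"
      using F by (simp add: \<xi> less_imp_le)
    show "(\<lambda>j. sqrt (F * (real j + 1)) - sqrt (F * real j)) \<longlonglongrightarrow> 0"
      using F by real_asymp
  qed simp
  have 3: "(\<lambda>j. sqrt (F * real (j + k)) - sqrt (F * real j)) \<longlonglongrightarrow> 0"
    using F by real_asymp
  have "(\<lambda>j. \<gamma> (real j + 1) - \<gamma> (real j) - sqrt (F * real j)) \<longlonglongrightarrow> 0"
    using tendsto_add[OF 1 2] by (simp add: \<xi>(3))
  then have "(\<lambda>j. \<gamma> (real (j + k) + 1) - \<gamma> (real (j + k)) - sqrt (F * real (j + k))) \<longlonglongrightarrow> 0"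
    by (rule LIMSEQ_ignore_initial_segment)
  from tendsto_add[OF tendsto_add[OF this 3] Suc]
  show ?case
    by (simp add: algebra_simps)
qed simp

section \<open>Increments of the perturbation \<open>h\<close> and the final estimate\<close>

lemma increments_tendsto_0:
  fixes h :: "nat \<Rightarrow> real"
  assumes "(\<lambda>j. h (Suc j) - h j) \<longlonglongrightarrow> 0"
  shows "(\<lambda>j. h (j + k) - h j) \<longlonglongrightarrow> 0"
proof (induction k)
  case (Suc k)
  from tendsto_add[OF LIMSEQ_ignore_initial_segment[OF assms, of k] Suc] show ?case
    by simp
qed simp

theorem theorem4p3:
  fixes \<mu> F E :: real and \<gamma> :: "real \<Rightarrow> real" and h :: "nat \<Rightarrow> real"
  assumes "\<mu> > 0" and "F > 0"
    and "continuous_on UNIV \<gamma>"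
    and "\<And>x. ref_zeta F E x = complex_of_real (cmod (ref_zeta F E x)) * exp (\<i> * complex_of_real (\<gamma> x))"
    and "-pi < \<gamma> 0" and "\<gamma> 0 \<le> pi"
    and "(\<lambda>j. \<bar>h (j+1) - h j\<bar> * real j powr (1/4)) \<longlonglongrightarrow> 0"
  shows "(\<lambda>N. \<Sum>j=1..N. exp (\<i> * complex_of_real (\<mu> * \<gamma> (real j) + h j))
              / complex_of_real ((deriv \<gamma> (real j))\<^sup>2))
         \<in> o(\<lambda>N. complex_of_real (ln (real N)))"
proof -
  define n where "n x = (norm (ref_zeta F E x))\<^sup>2" for x
  have der: "(\<gamma> has_field_derivative 1 / n x) (at x)" for x
    unfolding n_def using assms(2-4) by (rule phase_deriv)
  have n_lim: "((\<lambda>x. (n x)\<^sup>2 * x) \<longlongrightarrow> 1 / F) at_top"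
    unfolding n_def using assms(2) by (rule phase_deriv_asymp)
  have \<gamma>_inc: "(\<lambda>j. \<gamma> (real (j + k)) - \<gamma> (real j) - real k * sqrt (F * real j)) \<longlonglongrightarrow> 0" for k
    using assms(2) der by (rule phase_increment) (use phase_deriv_asymp[OF assms(2)] in \<open>simp add: n_def\<close>)
  have "(\<lambda>j. h (Suc j) - h j) \<longlonglongrightarrow> 0"
  proof (rule Lim_null_comparison[OF _ assms(7)])
    show "\<forall>\<^sub>F j in sequentially. norm (h (Suc j) - h j) \<le> \<bar>h (j + 1) - h j\<bar> * real j powr (1/4)"
    proof (rule eventually_mono[OF eventually_ge_at_top[of 1]])
      fix j :: nat assume "1 \<le> j"
      \<comment> \<open>Hence the weighted increments of the assumption dominate the plain
        ones.\<close>
      then have "real j powr (1/4) \<ge> 1"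
        by (intro ge_one_powr_ge_zero) auto
      then show "norm (h (Suc j) - h j) \<le> \<bar>h (j + 1) - h j\<bar> * real j powr (1/4)"
        by (simp add: mult_le_cancel_left1)
    qed
  qed
  then have h_inc: "(\<lambda>j. h (j + k) - h j) \<longlonglongrightarrow> 0" for k
    by (rule increments_tendsto_0)
  define \<theta> where "\<theta> = \<mu> * sqrt F"
  define u where "u j = cis (\<mu> * \<gamma> (real j) + h j)" for j
  have u_lim: "log_mean u \<longlonglongrightarrow> 0"
  proof (rule log_mean_slowly_varying_frequency)
    show "\<theta> \<noteq> 0"
      using assms(1,2) by (simp add: \<theta>_def)
    show "norm (u j) = 1" for j
      by (simp add: u_def)
    fix k
    \<comment> \<open>\<delta> is the deviation of the true phase change over \<open>k\<close> steps
      from the model \<open>k * \<theta> * sqrt j\<close>, so the ratio of \<open>u (j + k)\<close>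
      to its model value is exactly \<open>cis (\<delta> j)\<close>.\<close>
    define \<delta> where "\<delta> j = \<mu> * (\<gamma> (real (j + k)) - \<gamma> (real j) - real k * sqrt (F * real j)) + (h (j + k) - h j)" for j
    have "\<delta> \<longlonglongrightarrow> \<mu> * 0 + 0"
      unfolding \<delta>_def by (intro tendsto_intros \<gamma>_inc h_inc)
    then have "(\<lambda>j. cis (\<delta> j) - 1) \<longlonglongrightarrow> cis 0 - 1"
      by (intro tendsto_intros) simp
    then have "(\<lambda>j. norm (cis (\<delta> j) - 1)) \<longlonglongrightarrow> 0"
      by (intro tendsto_norm_zero) simp
    then show "(\<lambda>j. u (j + k) - u j * cis (real k * (\<theta> * sqrt (real j)))) \<longlonglongrightarrow> 0"
    proof (rule Lim_null_comparison[rotated], intro always_eventually allI)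
      fix j
      have "u (j + k) = u j * cis (real k * (\<theta> * sqrt (real j))) * cis (\<delta> j)"
        by (simp add: u_def \<delta>_def \<theta>_def cis_mult real_sqrt_mult algebra_simps)
      then have "u (j + k) - u j * cis (real k * (\<theta> * sqrt (real j)))
          = u j * cis (real k * (\<theta> * sqrt (real j))) * (cis (\<delta> j) - 1)"
        by (simp add: algebra_simps)
      then show "norm (u (j + k) - u j * cis (real k * (\<theta> * sqrt (real j)))) \<le> norm (cis (\<delta> j) - 1)"
        by (simp add: norm_mult u_def)
    qed
  qed
  \<comment> \<open>Since \<gamma>' is \<open>1 / n\<close>, the factor
    \<open>1 / \<gamma>' ^ 2\<close> is \<open>w j / j\<close> with \<open>w\<close> convergent.
    This is where the logarithmic weight in the sum comes from.\<close>
  define w where "w j = (n (real j))\<^sup>2 * real j" for j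
  have w_lim: "w \<longlonglongrightarrow> 1 / F"
    unfolding w_def by (rule filterlim_compose[OF n_lim filterlim_real_sequentially])
  have "(\<lambda>j. norm (w j - 1 / F)) \<longlonglongrightarrow> 0"
    using tendsto_norm_zero[OF LIM_zero[OF w_lim]] .
  then have "(\<lambda>j. u j * of_real (w j - 1 / F)) \<longlonglongrightarrow> 0"
    by (rule Lim_null_comparison[rotated]) (simp add: norm_mult u_def del: of_real_diff)
  \<comment> \<open>Split \<open>w j\<close> into its limit \<open>1 / F\<close>, which multiplies
    the vanishing mean of \<open>u\<close>, and a null sequence.\<close>
  from tendsto_add[OF log_mean_tendsto_0[OF this] tendsto_mult_right_zero[OF u_lim, of "of_real (1 / F)"]]
  have "log_mean (\<lambda>j. u j * of_real (w j)) \<longlonglongrightarrow> 0"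
    unfolding log_mean_mult_left [symmetric] log_mean_add [symmetric] by (simp add: algebra_simps)
  from tendsto_mult[OF tendsto_of_real[OF harm_div_ln_tendsto_1] this]
  have lim: "(\<lambda>N. of_real (harm N / ln (real N)) * log_mean (\<lambda>j. u j * of_real (w j)) N) \<longlonglongrightarrow> 0"
    by simp
  have sum: "(\<Sum>j=1..N. exp (\<i> * complex_of_real (\<mu> * \<gamma> (real j) + h j)) / complex_of_real ((deriv \<gamma> (real j))\<^sup>2))
      = of_real (harm N) * log_mean (\<lambda>j. u j * of_real (w j)) N" if "N \<ge> 1" for N
  proof -
    have "(\<Sum>j=1..N. exp (\<i> * complex_of_real (\<mu> * \<gamma> (real j) + h j)) / complex_of_real ((deriv \<gamma> (real j))\<^sup>2))
        = (\<Sum>j=1..N. (u j * of_real (w j)) /\<^sub>R real j)"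
    proof (rule sum.cong)
      fix j assume "j \<in> {1..N}"
      moreover have "deriv \<gamma> (real j) = 1 / n (real j)"
        using der by (rule DERIV_imp_deriv)
      ultimately show "exp (\<i> * complex_of_real (\<mu> * \<gamma> (real j) + h j)) / complex_of_real ((deriv \<gamma> (real j))\<^sup>2)
          = (u j * of_real (w j)) /\<^sub>R real j"
        by (simp add: u_def w_def cis_conv_exp scaleR_conv_of_real power_divide)
    qed simp
    moreover have "harm N > (0 :: real)"
      using that by (simp add: harm_pos)
    then have "harm N \<noteq> (0 :: real)"
      by (rule less_imp_neq [symmetric])
    ultimately show ?thesis
      by (simp add: log_mean_def scaleR_conv_of_real)
  qed
  show ?thesis
  proof (rule smalloI_tendsto)
    show "\<forall>\<^sub>F N in sequentially. complex_of_real (ln (real N)) \<noteq> 0"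
      by (rule eventually_mono[OF eventually_gt_at_top[of 1]]) simp
    have "\<forall>\<^sub>F N in sequentially. of_real (harm N / ln (real N)) * log_mean (\<lambda>j. u j * of_real (w j)) N =
        (\<Sum>j=1..N. exp (\<i> * complex_of_real (\<mu> * \<gamma> (real j) + h j)) / complex_of_real ((deriv \<gamma> (real j))\<^sup>2))
          / complex_of_real (ln (real N))"
      by (rule eventually_mono[OF eventually_ge_at_top[of 1]]) (simp only: sum of_real_divide times_divide_eq_left)
    with lim show "(\<lambda>N. (\<Sum>j=1..N. exp (\<i> * complex_of_real (\<mu> * \<gamma> (real j) + h j))
        / complex_of_real ((deriv \<gamma> (real j))\<^sup>2)) / complex_of_real (ln (real N))) \<longlonglongrightarrow> 0"
      by (rule Lim_transform_eventually)
  qed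
qed

end
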